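(* There exists a function $f$ with $f(n)=o(n)$ such that for all integers $m\ge1$, $0\le n\le m$, and every $S\subseteq[m]$ with $|S|=n$, there is a representation of $S$ using at most $\mathcal{B}(n,m)+f(n)$ bits that supports $\mathrm{select}(i,S)$ (the $i$-th smallest element of $S$, $1\le i\le n$) in constant time on the word RAM with word size $\Theta(\lg m)$.
   Context: $[m]=\{0,\dots,m-1\}$, $\lg=\log_2$, $\mathcal{B}(n,m)=\lceil\lg\binom{m}{n}\rceil$. Word RAM: words of $w$ bits with constant-time arithmetic and bitwise operations; constant time means independent of $n,m,S$. *)

theory Defs
  imports Complex_Main "HOL-Library.Landau_Symbols"
begin

definition info_bound :: "nat \<Rightarrow> nat \<Rightarrow> int" where
  "info_bound n m = \<lceil>log 2 (real (m choose n))\<rceil>"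

definition select :: "nat \<Rightarrow> nat set \<Rightarrow> nat" where
  "select i S = sorted_list_of_set S ! (i - 1)"

text \<open>
  A word RAM. The word size \<open>w\<close> varies with the universe size, so a word is a natural number
  below \<open>2 ^ w\<close> rather than an element of a fixed word type. All operations truncate their
  result to \<open>w\<close> bits; division and remainder by \<open>0\<close> follow the HOL conventions.
\<close>

datatype binop = Add | Sub | Mul | Div | Mod | And | Or | Xor | Shl | Shr

fun binop_val :: "nat \<Rightarrow> binop \<Rightarrow> nat \<Rightarrow> nat \<Rightarrow> nat" where
  "binop_val w Add x y = take_bit w (x + y)"
| "binop_val w Sub x y = take_bit w (x + 2 ^ w - y)"
| "binop_val w Mul x y = take_bit w (x * y)"
| "binop_val w Div x y = x div y"
| "binop_val w Mod x y = x mod y"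
| "binop_val w And x y = Bit_Operations.and x y"
| "binop_val w Or x y = Bit_Operations.or x y"
| "binop_val w Xor x y = Bit_Operations.xor x y"
| "binop_val w Shl x y = take_bit w (push_bit y x)"
| "binop_val w Shr x y = drop_bit y x"

text \<open>Register names, literals and jump targets are fixed in the program text; memory is
  addressed indirectly, through the contents of a register.\<close>

datatype instr =
    Const nat nat
  | Op binop nat nat nat
  | Not nat nat
  | Load nat nat
  | Store nat nat
  | Jump nat
  | Jump_Eq nat nat nat
  | Jump_Less nat nat nat

record config =
  pc :: nat
  reg :: "nat \<Rightarrow> nat"
  mem :: "nat \<Rightarrow> nat"

definition set_reg :: "nat \<Rightarrow> nat \<Rightarrow> config \<Rightarrow> config" where
  "set_reg d v s = s\<lparr>reg := (reg s)(d := v), pc := Suc (pc s)\<rparr>"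

fun exec :: "nat \<Rightarrow> instr \<Rightarrow> config \<Rightarrow> config" where
  "exec w (Const d k) s = set_reg d (take_bit w k) s"
| "exec w (Op f d a b) s = set_reg d (binop_val w f (reg s a) (reg s b)) s"
| "exec w (Not d a) s = set_reg d (Bit_Operations.xor (mask w) (reg s a)) s"
| "exec w (Load d a) s = set_reg d (mem s (reg s a)) s"
| "exec w (Store a b) s = s\<lparr>mem := (mem s)(reg s a := reg s b), pc := Suc (pc s)\<rparr>"
| "exec w (Jump t) s = s\<lparr>pc := t\<rparr>"
| "exec w (Jump_Eq a b t) s = s\<lparr>pc := (if reg s a = reg s b then t else Suc (pc s))\<rparr>"
| "exec w (Jump_Less a b t) s = s\<lparr>pc := (if reg s a < reg s b then t else Suc (pc s))\<rparr>"

definition halted :: "instr list \<Rightarrow> config \<Rightarrow> bool" where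
  "halted P s \<longleftrightarrow> length P \<le> pc s"

definition step :: "nat \<Rightarrow> instr list \<Rightarrow> config \<Rightarrow> config" where
  "step w P s = (if halted P s then s else exec w (P ! pc s) s)"

text \<open>Word \<open>a\<close> of the memory image of a bit string: bits \<open>a * w, \<dots>, a * w + w - 1\<close>, least
  significant first, padded with zeros past the end of the string.\<close>

definition pack :: "nat \<Rightarrow> bool list \<Rightarrow> nat \<Rightarrow> nat" where
  "pack w bits a = horner_sum of_bool 2 (take w (drop (a * w) bits))"

text \<open>Besides the query index, the program is told the parameters \<open>n\<close>, \<open>m\<close> and the word size;
  everything else it learns about \<open>S\<close> must come from the stored bits.\<close>

definition query_config :: "nat \<Rightarrow> nat \<Rightarrow> nat \<Rightarrow> bool list \<Rightarrow> nat \<Rightarrow> config" where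
  "query_config w n m bits i =
     \<lparr>pc = 0, reg = (\<lambda>_. 0)(0 := i, 1 := n, 2 := m, 3 := w), mem = pack w bits\<rparr>"

text \<open>Every query halts within \<open>T\<close> steps (a halted configuration is a fixed point of
  \<^const>\<open>step\<close>), leaves its answer in register \<open>0\<close>, and leaves the stored representation
  intact for later queries.\<close>

definition supports_select ::
  "instr list \<Rightarrow> nat \<Rightarrow> nat \<Rightarrow> nat \<Rightarrow> nat \<Rightarrow> nat set \<Rightarrow> bool list \<Rightarrow> bool" where
  "supports_select P T w n m S bits \<longleftrightarrow>
     (\<forall>i\<in>{1..n}. \<exists>s. s = (step w P ^^ T) (query_config w n m bits i) \<and>
        halted P s \<and> reg s 0 = select i S \<and>
        (\<forall>a. a * w < length bits \<longrightarrow> mem s a = pack w bits a))"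

end

theory Submission
  imports Defs "HOL-Real_Asymp.Real_Asymp"
begin

text \<open>Quotienting the elements by a suitable number \<open>Q\<close> leaves quotients in a universe of size
  \<open>O(n lg n)\<close>; the remainders are stored verbatim. Adding the index to each quotient makes the sequence
  strictly increasing, and by the choice of \<open>Q\<close> the total information grows by \<open>o(n)\<close> bits only
  (if \<open>m = O(n lg n)\<close>, then \<open>Q = 1\<close> and nothing is added).

  An increasing sequence in a universe of size \<open>U = O(n lg n)\<close> is cut into blocks of consecutive
  elements, grouped into superblocks. A block of \<open>b\<close> elements that stretches over \<open>t\<close> values is encoded
  by its number among the \<open>t choose b\<close> possible sets; since \<open>(t choose b) * (t' choose b')\<close> is at most
  \<open>(t + t') choose (b + b')\<close>, all codes take at most \<open>lg (U choose n)\<close> bits plus one bit for each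
  block. Superblocks get absolute pointers and blocks get pointers relative to their superblock; a
  table of size \<open>o(n)\<close> decodes a block. The few superblocks that stretch too far are stored
  verbatim.\<close>

section \<open>Compiling expressions to the word RAM\<close>

text \<open>The obstacle is that \<open>f\<close> depends on \<open>n\<close> alone: neither
  \<open>lg (lg m)\<close> bits for a shift amount nor a constant number of bits per element may be
  wasted. A universe of about \<open>n lg n\<close> values is a compromise. It exceeds
  \<open>n\<close> by enough that adding the index multiplies each of the \<open>n\<close> factors
  of the binomial coefficient by only \<open>1 + O(1 / lg n)\<close>, in total
  \<open>2 ^ O(n / lg n)\<close>; yet absolute pointers into it have \<open>O(lg n)\<close> bits.
  Blocks of \<open>(lg (lg n)) ^ 2\<close> elements balance two costs: records of
  \<open>O(lg (lg n))\<close> bits and one rounding bit per block sum to \<open>o(n)\<close>, while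
  the table has \<open>2 ^ O((lg (lg n)) ^ 3)\<close> bits, which is \<open>n ^ o(1)\<close>. The
  word RAM has no logarithm, so the widths that the program needs come from a self-delimiting
  header. Word sizes below a constant, for which addresses could overflow, admit only finitely many
  \<open>n\<close>; verbatim storage for them is absorbed by \<open>f\<close>.\<close>

definition occurs_at :: "'a list \<Rightarrow> nat \<Rightarrow> 'a list \<Rightarrow> bool" where
  "occurs_at zs p xs \<longleftrightarrow> (\<exists>pre post. zs = pre @ xs @ post \<and> length pre = p)"

lemma occurs_at_appendD:
  assumes "occurs_at zs p (xs @ ys)"
  shows "occurs_at zs p xs" "occurs_at zs (p + length xs) ys"
proof -
  obtain pre post where *: "zs = pre @ (xs @ ys) @ post" "length pre = p"
    using assms unfolding occurs_at_def by blast
  show "occurs_at zs p xs"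
    unfolding occurs_at_def using * by (intro exI[of _ pre] exI[of _ "ys @ post"]) simp
  show "occurs_at zs (p + length xs) ys"
    unfolding occurs_at_def using * by (intro exI[of _ "pre @ xs"] exI[of _ post]) simp
qed

lemma occurs_at_ConsD:
  assumes "occurs_at zs p (x # xs)"
  shows "p < length zs" "zs ! p = x" "occurs_at zs (Suc p) xs"
proof -
  obtain pre post where *: "zs = pre @ (x # xs) @ post" "length pre = p"
    using assms unfolding occurs_at_def by blast
  show "p < length zs" "zs ! p = x"
    using * by (auto simp: nth_append)
  show "occurs_at zs (Suc p) xs"
    unfolding occurs_at_def using * by (intro exI[of _ "pre @ [x]"] exI[of _ post]) simp
qed

lemma occurs_at_self: "occurs_at zs 0 zs"
  unfolding occurs_at_def by (rule exI[of _ "[]"]) simp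

lemma length_concat_map: "length (concat (map f [0..<k])) = (\<Sum>j<k. length (f j))"
  by (induction k) auto

lemma occurs_at_concat_map:
  assumes "occurs_at zs p (concat (map f [0..<n]))" "k < n"
  shows "occurs_at zs (p + (\<Sum>j<k. length (f j))) (f k)"
proof -
  have "[0..<n] = [0..<k] @ k # [Suc k..<n]"
    using assms(2) upt_add_eq_append[of 0 k "n - k"] upt_conv_Cons[of k n] by simp
  then have "concat (map f [0..<n]) = concat (map f [0..<k]) @ f k @ concat (map f [Suc k..<n])"
    by simp
  then show ?thesis
    unfolding length_concat_map[symmetric]
    using occurs_at_appendD(1)[OF occurs_at_appendD(2)[of zs p "concat (map f [0..<k])"]] assms(1)
    by metis
qed

text \<open>Queries are loop-free expressions: correctness becomes an equation about
  \<open>eval\<close>, and constant time is a property of the program text.\<close>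

datatype expr =
    Var nat
  | Lit nat
  | Bin binop expr expr
  | Fetch expr
  | If_Less expr expr expr expr

fun eval :: "nat \<Rightarrow> (nat \<Rightarrow> nat) \<Rightarrow> (nat \<Rightarrow> nat) \<Rightarrow> expr \<Rightarrow> nat" where
  "eval w M \<rho> (Var r) = \<rho> r"
| "eval w M \<rho> (Lit k) = take_bit w k"
| "eval w M \<rho> (Bin f a b) = binop_val w f (eval w M \<rho> a) (eval w M \<rho> b)"
| "eval w M \<rho> (Fetch a) = M (eval w M \<rho> a)"
| "eval w M \<rho> (If_Less a b t u) =
     (if eval w M \<rho> a < eval w M \<rho> b then eval w M \<rho> t else eval w M \<rho> u)"

fun vars :: "expr \<Rightarrow> nat set" where
  "vars (Var r) = {r}"
| "vars (Lit k) = {}"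
| "vars (Bin f a b) = vars a \<union> vars b"
| "vars (Fetch a) = vars a"
| "vars (If_Less a b t u) = vars a \<union> vars b \<union> vars t \<union> vars u"

fun code_size :: "expr \<Rightarrow> nat" where
  "code_size (Var r) = 1"
| "code_size (Lit k) = 1"
| "code_size (Bin f a b) = code_size a + code_size b + 1"
| "code_size (Fetch a) = code_size a + 1"
| "code_size (If_Less a b t u) = code_size a + code_size b + code_size u + code_size t + 2"

text \<open>\<open>compile d s e\<close> is to be placed at address \<open>s\<close>; it leaves the value of \<open>e\<close> in register \<open>d\<close>
  and uses only registers from \<open>d\<close> on as scratch space. There are only forward jumps, so the code
  size bounds the running time.\<close>

fun compile :: "nat \<Rightarrow> nat \<Rightarrow> expr \<Rightarrow> instr list" where
  "compile d s (Var r) = [Op Or d r r]"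
| "compile d s (Lit k) = [Const d k]"
| "compile d s (Bin f a b) =
     compile d s a @ compile (Suc d) (s + code_size a) b @ [Op f d d (Suc d)]"
| "compile d s (Fetch a) = compile d s a @ [Load d d]"
| "compile d s (If_Less a b t u) =
     (let p = s + code_size a + code_size b; q = p + code_size u + 2 in
      compile d s a @ compile (Suc d) (s + code_size a) b @ [Jump_Less d (Suc d) q] @
      compile d (p + 1) u @ [Jump (q + code_size t)] @ compile d q t)"

lemma length_compile [simp]: "length (compile d s e) = code_size e"
  by (induction e arbitrary: d s) (auto simp: Let_def)

text \<open>An upper bound on the number of steps suffices, as the branches of a conditional may
  take different times.\<close>

definition reaches :: "nat \<Rightarrow> instr list \<Rightarrow> nat \<Rightarrow> config \<Rightarrow> config \<Rightarrow> bool" where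
  "reaches w P k c c' \<longleftrightarrow> (\<exists>j\<le>k. (step w P ^^ j) c = c')"

lemma reaches_trans:
  assumes "reaches w P k a b" "reaches w P l b c"
  shows "reaches w P (k + l) a c"
proof -
  obtain i j where "i \<le> k" "(step w P ^^ i) a = b" "j \<le> l" "(step w P ^^ j) b = c"
    using assms unfolding reaches_def by blast
  then have "(step w P ^^ (j + i)) a = c" "j + i \<le> k + l"
    by (auto simp: funpow_add)
  then show ?thesis unfolding reaches_def by blast
qed

lemma reaches_mono: "reaches w P k a b \<Longrightarrow> k \<le> l \<Longrightarrow> reaches w P l a b"
  unfolding reaches_def using order_trans by blast

lemma reaches_exec:
  assumes "occurs_at P (pc c) (x # xs)"
  shows "reaches w P 1 c (exec w x c)"
  using occurs_at_ConsD[OF assms] unfolding reaches_def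
  by (intro exI[of _ 1]) (simp add: step_def halted_def)

text \<open>The clause on registers below \<open>d\<close> protects the query parameters and the
  value of a first operand while the second one is computed.\<close>

definition computes :: "nat \<Rightarrow> instr list \<Rightarrow> nat \<Rightarrow> expr \<Rightarrow> config \<Rightarrow> config \<Rightarrow> bool" where
  "computes w P d e c c' \<longleftrightarrow>
     reaches w P (code_size e) c c' \<and> pc c' = pc c + code_size e \<and>
     reg c' d = eval w (mem c) (reg c) e \<and> (\<forall>r<d. reg c' r = reg c r) \<and> mem c' = mem c"

lemma eval_cong:
  assumes "\<And>r. r \<in> vars e \<Longrightarrow> \<rho> r = \<rho>' r"
  shows "eval w M \<rho> e = eval w M \<rho>' e"
  using assms
proof (induction e)
  case (If_Less a b t u)
  then have "eval w M \<rho> a = eval w M \<rho>' a" "eval w M \<rho> b = eval w M \<rho>' b"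
    "eval w M \<rho> t = eval w M \<rho>' t" "eval w M \<rho> u = eval w M \<rho>' u" by simp_all
  then show ?case by simp
next
  case (Bin f a b)
  then have "eval w M \<rho> a = eval w M \<rho>' a" "eval w M \<rho> b = eval w M \<rho>' b" by simp_all
  then show ?case by simp
qed auto

lemma compile_correct:
  assumes "occurs_at P (pc c) (compile d (pc c) e)" "vars e \<subseteq> {..<d}"
  shows "\<exists>c'. computes w P d e c c'"
  using assms
proof (induction e arbitrary: d c)
  case (Var r)
  have "reaches w P 1 c (exec w (Op Or d r r) c)"
    using Var(1) by (intro reaches_exec[of _ _ _ "[]"]) simp
  then show ?case
    by (intro exI[of _ "exec w (Op Or d r r) c"]) (simp add: computes_def set_reg_def)
next
  case (Lit k)
  have "reaches w P 1 c (exec w (Const d k) c)"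
    using Lit(1) by (intro reaches_exec[of _ _ _ "[]"]) simp
  then show ?case
    by (intro exI[of _ "exec w (Const d k) c"]) (simp add: computes_def set_reg_def)
next
  case (Bin f a b)
  have at: "occurs_at P (pc c) (compile d (pc c) a)"
    "occurs_at P (pc c + code_size a) (compile (Suc d) (pc c + code_size a) b)"
    "occurs_at P (pc c + code_size a + code_size b) [Op f d d (Suc d)]"
    using occurs_at_appendD[OF Bin.prems(1)[unfolded compile.simps]]
      occurs_at_appendD[OF occurs_at_appendD(2)[OF Bin.prems(1)[unfolded compile.simps]]]
    by simp_all
  obtain c1 where c1: "computes w P d a c c1"
    using Bin.IH(1)[OF at(1)] Bin.prems(2) by auto
  obtain c2 where c2: "computes w P (Suc d) b c1 c2"
  proof (rule exE[OF Bin.IH(2)])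
    show "occurs_at P (pc c1) (compile (Suc d) (pc c1) b)"
      using at(2) c1 by (simp add: computes_def)
    show "vars b \<subseteq> {..<Suc d}"
      using Bin.prems(2) by fastforce
  qed
  let ?c3 = "exec w (Op f d d (Suc d)) c2"
  have 3: "reaches w P 1 c2 ?c3"
    using at(3) c1 c2 by (intro reaches_exec[of _ _ _ "[]"]) (simp add: computes_def)
  have "eval w (mem c) (reg c1) b = eval w (mem c) (reg c) b"
    using Bin.prems(2) c1 by (intro eval_cong) (auto simp: computes_def)
  moreover have "reaches w P (code_size a + code_size b + 1) c ?c3"
    using c1 c2 3 by (intro reaches_trans[of _ _ _ c c2] reaches_trans[of _ _ _ c c1])
      (simp_all only: computes_def)
  ultimately show ?case
    using c1 c2 by (intro exI[of _ ?c3]) (simp add: computes_def set_reg_def)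
next
  case (Fetch a)
  have at: "occurs_at P (pc c) (compile d (pc c) a)" "occurs_at P (pc c + code_size a) [Load d d]"
    using occurs_at_appendD[OF Fetch.prems(1)[unfolded compile.simps]] by simp_all
  obtain c1 where c1: "computes w P d a c c1"
    using Fetch.IH[OF at(1)] Fetch.prems(2) by auto
  let ?c2 = "exec w (Load d d) c1"
  have 2: "reaches w P 1 c1 ?c2"
    using at(2) c1 by (intro reaches_exec[of _ _ _ "[]"]) (simp add: computes_def)
  have "reaches w P (code_size a + 1) c ?c2"
    using c1 2 by (intro reaches_trans[of _ _ _ c c1]) (simp_all only: computes_def)
  then show ?case
    using c1 by (intro exI[of _ ?c2]) (simp add: computes_def set_reg_def)
next
  case (If_Less a b t u)
  define p where "p = pc c + code_size a + code_size b"
  define q where "q = p + code_size u + 2"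
  have cat: "compile d (pc c) (If_Less a b t u) =
      compile d (pc c) a @ compile (Suc d) (pc c + code_size a) b @ [Jump_Less d (Suc d) q] @
      compile d (p + 1) u @ [Jump (q + code_size t)] @ compile d q t"
    by (simp add: p_def q_def Let_def)
  note at0 = If_Less.prems(1)[unfolded cat]
  have at: "occurs_at P (pc c) (compile d (pc c) a)"
    "occurs_at P (pc c + code_size a) (compile (Suc d) (pc c + code_size a) b)"
    "occurs_at P p [Jump_Less d (Suc d) q]"
    "occurs_at P (p + 1) (compile d (p + 1) u)"
    "occurs_at P (p + 1 + code_size u) [Jump (q + code_size t)]"
    "occurs_at P q (compile d q t)"
  proof -
    note D = occurs_at_appendD
    note r1 = D(2)[OF at0]
    note r2 = D(2)[OF r1]
    note r3 = D(2)[OF r2]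
    note r4 = D(2)[OF r3]
    note r5 = D(2)[OF r4]
    show "occurs_at P (pc c) (compile d (pc c) a)" using D(1)[OF at0] .
    show "occurs_at P (pc c + code_size a) (compile (Suc d) (pc c + code_size a) b)"
      using D(1)[OF r1] by simp
    show "occurs_at P p [Jump_Less d (Suc d) q]" using D(1)[OF r2] by (simp add: p_def)
    show "occurs_at P (p + 1) (compile d (p + 1) u)" using D(1)[OF r3] by (simp add: p_def)
    show "occurs_at P (p + 1 + code_size u) [Jump (q + code_size t)]"
      using D(1)[OF r4] by (simp add: p_def)
    show "occurs_at P q (compile d q t)"
      using r5 by (simp add: p_def q_def add.assoc numeral_2_eq_2)
  qed
  obtain c1 where c1: "computes w P d a c c1"
  proof (rule exE[OF If_Less.IH(1)[OF at(1)]])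
    show "vars a \<subseteq> {..<d}"
      using If_Less.prems(2) by simp
  qed
  obtain c2 where c2: "computes w P (Suc d) b c1 c2"
  proof (rule exE[OF If_Less.IH(2)])
    show "occurs_at P (pc c1) (compile (Suc d) (pc c1) b)"
      using at(2) c1 by (simp add: computes_def)
    show "vars b \<subseteq> {..<Suc d}"
      using If_Less.prems(2) by fastforce
  qed
  have ev: "eval w (mem c) (reg c1) b = eval w (mem c) (reg c) b"
    using If_Less.prems(2) c1 by (intro eval_cong) (auto simp: computes_def)
  let ?c3 = "exec w (Jump_Less d (Suc d) q) c2"
  have "reaches w P 1 c2 ?c3"
    using at(3) c1 c2 by (intro reaches_exec[of _ _ _ "[]"]) (simp add: computes_def p_def)
  then have r3: "reaches w P (code_size a + code_size b + 1) c ?c3"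
    using c1 c2 by (intro reaches_trans[of _ _ _ c c2] reaches_trans[of _ _ _ c c1])
      (simp_all only: computes_def)
  have pc3: "pc ?c3 = (if eval w (mem c) (reg c) a < eval w (mem c) (reg c) b then q else p + 1)"
    using c1 c2 ev by (simp add: computes_def p_def)
  have regs3: "\<forall>r<d. reg ?c3 r = reg c r" "mem ?c3 = mem c"
    using c1 c2 by (auto simp: computes_def)
  have evt: "eval w (mem c) (reg ?c3) t = eval w (mem c) (reg c) t"
    and evu: "eval w (mem c) (reg ?c3) u = eval w (mem c) (reg c) u"
    using If_Less.prems(2) regs3 by (auto intro!: eval_cong)
  show ?case
  proof (cases "eval w (mem c) (reg c) a < eval w (mem c) (reg c) b")
    case True
    obtain c4 where c4: "computes w P d t ?c3 c4"
    proof (rule exE[OF If_Less.IH(3)])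
      show "occurs_at P (pc ?c3) (compile d (pc ?c3) t)"
        using at(6) by (simp only: pc3 True if_True)
      show "vars t \<subseteq> {..<d}"
        using If_Less.prems(2) by simp
    qed
    have "reaches w P (code_size a + code_size b + 1 + code_size t) c c4"
      using c4 by (intro reaches_trans[OF r3]) (simp_all only: computes_def)
    then have "reaches w P (code_size (If_Less a b t u)) c c4"
      by (rule reaches_mono) simp
    then show ?thesis
      using c4 True regs3 evt pc3 by (intro exI[of _ c4]) (simp add: computes_def q_def p_def)
  next
    case False
    obtain c4 where c4: "computes w P d u ?c3 c4"
    proof (rule exE[OF If_Less.IH(4)])
      show "occurs_at P (pc ?c3) (compile d (pc ?c3) u)"
        using at(4) by (simp only: pc3 False if_False)
      show "vars u \<subseteq> {..<d}"
        using If_Less.prems(2) by simp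
    qed
    let ?c5 = "exec w (Jump (q + code_size t)) c4"
    have "reaches w P 1 c4 ?c5"
      using at(5) c4 pc3 False by (intro reaches_exec[of _ _ _ "[]"]) (simp add: computes_def)
    then have "reaches w P (code_size a + code_size b + 1 + code_size u + 1) c ?c5"
      using c4 by (intro reaches_trans[of _ _ _ c c4] reaches_trans[OF r3]) (simp_all only: computes_def)
    then have "reaches w P (code_size (If_Less a b t u)) c ?c5"
      by (rule reaches_mono) simp
    then show ?thesis
      using c4 False regs3 evu pc3 by (intro exI[of _ ?c5]) (simp add: computes_def q_def p_def)
  qed
qed

text \<open>Registers 0 to 3 hold the query, so scratch space starts at 4; the final
  \<open>Or\<close> moves the result to register 0.\<close>

definition program :: "expr \<Rightarrow> instr list" where
  "program e = compile 4 0 e @ [Op Or 0 4 4]"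

definition query_regs :: "nat \<Rightarrow> nat \<Rightarrow> nat \<Rightarrow> nat \<Rightarrow> nat \<Rightarrow> nat" where
  "query_regs w n m i = (\<lambda>_. 0)(0 := i, 1 := n, 2 := m, 3 := w)"

lemma funpow_step_halted: "halted P c \<Longrightarrow> (step w P ^^ k) c = c"
  by (induction k) (auto simp: step_def)

text \<open>From here on only \<open>eval\<close> matters. Compiled code contains no
  \<open>Store\<close>, so the representation survives each query.\<close>

lemma supports_select_programI:
  assumes "vars e \<subseteq> {..<4}"
    and "\<And>i. i \<in> {1..n} \<Longrightarrow> eval w (pack w bits) (query_regs w n m i) e = select i S"
  shows "supports_select (program e) (Suc (code_size e)) w n m S bits"
  unfolding supports_select_def
proof (intro ballI exI conjI)
  fix i assume i: "i \<in> {1..n}"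
  let ?P = "program e" and ?c = "query_config w n m bits i"
  have at: "occurs_at ?P 0 (compile 4 0 e)" "occurs_at ?P (code_size e) [Op Or 0 4 4]"
    using occurs_at_appendD[OF occurs_at_self[of ?P, unfolded program_def]]
    by (auto simp: program_def)
  obtain c1 where c1: "computes w ?P 4 e ?c c1"
    using compile_correct[of ?P ?c 4 e w] at(1) assms(1) by (auto simp: query_config_def)
  let ?c2 = "exec w (Op Or 0 4 4) c1"
  have "reaches w ?P 1 c1 ?c2"
    using at(2) c1
    by (intro reaches_exec[of _ _ _ "[]"]) (simp add: computes_def query_config_def)
  then have "reaches w ?P (code_size e + 1) ?c ?c2"
    using c1 by (intro reaches_trans[of w ?P _ ?c c1]) (auto simp only: computes_def)
  then obtain j where j: "j \<le> Suc (code_size e)" "(step w ?P ^^ j) ?c = ?c2"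
    unfolding reaches_def by auto
  have halt: "halted ?P ?c2"
    using c1 by (simp add: computes_def halted_def program_def set_reg_def query_config_def)
  have "(step w ?P ^^ (Suc (code_size e))) ?c = (step w ?P ^^ (Suc (code_size e) - j)) ((step w ?P ^^ j) ?c)"
    using j(1) by (metis comp_apply funpow_add le_add_diff_inverse2)
  then have fin: "(step w ?P ^^ (Suc (code_size e))) ?c = ?c2"
    using funpow_step_halted[OF halt] j(2) by simp
  show "(step w ?P ^^ (Suc (code_size e))) ?c = (step w ?P ^^ (Suc (code_size e))) ?c" ..
  show "halted ?P ((step w ?P ^^ (Suc (code_size e))) ?c)"
    using halt fin by simp
  show "reg ((step w ?P ^^ (Suc (code_size e))) ?c) 0 = select i S"
    using c1 assms(2)[OF i] unfolding fin
    by (simp add: computes_def set_reg_def query_config_def query_regs_def)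
  show "\<forall>a. a * w < length bits \<longrightarrow> mem ((step w ?P ^^ (Suc (code_size e))) ?c) a = pack w bits a"
    using c1 unfolding fin by (simp add: computes_def set_reg_def query_config_def)
qed

section \<open>Reading bit fields\<close>

abbreviation bits_val :: "bool list \<Rightarrow> nat" where
  "bits_val \<equiv> horner_sum of_bool 2"

definition nat_bits :: "nat \<Rightarrow> nat \<Rightarrow> bool list" where
  "nat_bits d x = map (bit x) [0..<d]"

lemma length_nat_bits [simp]: "length (nat_bits d x) = d"
  by (simp add: nat_bits_def)

text \<open>The memory is seen as a single number, which makes reading a field a shift and a
  truncation and yields the zero padding for free.\<close>

lemma pack_eq: "pack w bits a = take_bit w (drop_bit (a * w) (bits_val bits))"
  unfolding pack_def
  by (rule bit_eqI) (auto simp: bit_horner_sum_bit_iff bit_take_bit_iff bit_drop_bit_eq)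

text \<open>The window of \<open>k\<close> bits may be wider than the field: this is how a block
  code is read whose length the program does not know.\<close>

lemma read_occurs_at:
  assumes "occurs_at bits p (nat_bits d x)" "d \<le> k"
  shows "take_bit d (take_bit k (drop_bit p (bits_val bits))) = take_bit d x"
proof -
  obtain pre post where *: "bits = pre @ nat_bits d x @ post" "length pre = p"
    using assms unfolding occurs_at_def by blast
  show ?thesis
    using assms(2)
    by (intro bit_eqI) (auto simp: * bit_horner_sum_bit_iff bit_take_bit_iff bit_drop_bit_eq
        nth_append nat_bits_def simp flip: *(2))
qed

lemma read_field:
  assumes "occurs_at bits p (nat_bits d x)" "x < 2 ^ d"
  shows "take_bit d (drop_bit p (bits_val bits)) = x"
  using read_occurs_at[OF assms(1) order_refl] assms(2) by (simp add: take_bit_nat_eq_self)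

text \<open>The second word supplies the bits from position \<open>w - r\<close> on. For
  \<open>r = 0\<close> it is shifted by all \<open>w\<close> bits and vanishes under
  \<open>take_bit\<close>.\<close>

lemma word_pair:
  fixes V :: nat
  assumes "r < w" "d \<le> w"
  shows "Bit_Operations.and
      (Bit_Operations.or (drop_bit r (take_bit w (drop_bit (a * w) V)))
         (take_bit w (push_bit (w - r) (take_bit w (drop_bit ((a + 1) * w) V)))))
      (mask d) = take_bit d (drop_bit (a * w + r) V)"
proof (rule bit_eqI)
  fix k
  have "(a + 1) * w + (k - (w - r)) = a * w + r + k" if "w - r \<le> k"
    using that assms(1) by simp
  moreover have "k - (w - r) < w" if "w - r \<le> k" "k < w" using that assms(1) by simp
  ultimately show "bit (Bit_Operations.and
      (Bit_Operations.or (drop_bit r (take_bit w (drop_bit (a * w) V)))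
         (take_bit w (push_bit (w - r) (take_bit w (drop_bit ((a + 1) * w) V)))))
      (mask d)) k = bit (take_bit d (drop_bit (a * w + r) V)) k"
    using assms
    by (auto simp: bit_and_iff bit_or_iff bit_mask_iff bit_take_bit_iff bit_drop_bit_eq
        bit_push_bit_iff ac_simps)
qed

text \<open>\<open>Read a t d\<close> reads the \<open>d \<le> w\<close> bits that start \<open>t\<close> bits after the beginning of word \<open>a\<close>; they
  may extend into a second word.\<close>

definition Read :: "expr \<Rightarrow> expr \<Rightarrow> expr \<Rightarrow> expr" where
  "Read a t d =
     (let A = Bin Add a (Bin Div t (Var 3)); r = Bin Mod t (Var 3) in
      Bin And
        (Bin Or (Bin Shr (Fetch A) r)
          (Bin Shl (Fetch (Bin Add A (Lit 1))) (Bin Sub (Var 3) r)))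
        (Bin Sub (Bin Shl (Lit 1) d) (Lit 1)))"

definition Pow2 :: "expr \<Rightarrow> expr" where
  "Pow2 d = Bin Shl (Lit 1) d"

lemma vars_Read [simp]: "vars (Read a t d) = vars a \<union> vars t \<union> vars d \<union> {3}"
  by (auto simp: Read_def Let_def)

lemma vars_Pow2 [simp]: "vars (Pow2 d) = vars d"
  by (auto simp: Pow2_def)

text \<open>With at least 8 bits per word, every literal below 256 survives truncation.\<close>

locale query =
  fixes w n m i :: nat and bits :: "bool list"
  assumes w_ge: "8 \<le> w"
begin

abbreviation ev :: "expr \<Rightarrow> nat" where
  "ev \<equiv> eval w (pack w bits) (query_regs w n m i)"

lemma w_less: "w < 2 ^ w" by simp

lemma ev_Var: "ev (Var 0) = i" "ev (Var 1) = n" "ev (Var 2) = m" "ev (Var 3) = w"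
  by (simp_all add: query_regs_def)

lemma ev_Lit: "k < 2 ^ w \<Longrightarrow> ev (Lit k) = k"
  by (simp add: take_bit_nat_eq_self)

lemma ev_Lit_small: "k < 256 \<Longrightarrow> ev (Lit k) = k"
  using power_increasing[OF w_ge, of "2::nat"] by (intro ev_Lit) simp

lemma ev_Add: "ev a = x \<Longrightarrow> ev b = y \<Longrightarrow> x + y < 2 ^ w \<Longrightarrow> ev (Bin Add a b) = x + y"
  by (simp add: take_bit_nat_eq_self)

lemma ev_Mul: "ev a = x \<Longrightarrow> ev b = y \<Longrightarrow> x * y < 2 ^ w \<Longrightarrow> ev (Bin Mul a b) = x * y"
  by (simp add: take_bit_nat_eq_self)

lemma ev_Sub:
  assumes "ev a = x" "ev b = y" "y \<le> x" "x < 2 ^ w"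
  shows "ev (Bin Sub a b) = x - y"
proof -
  have "x + 2 ^ w - y = (x - y) + 2 ^ w" using assms by simp
  then have "take_bit w (x + 2 ^ w - y) = (x - y) mod 2 ^ w" by (simp add: take_bit_eq_mod)
  then show ?thesis using assms by simp
qed

lemma ev_Div: "ev a = x \<Longrightarrow> ev b = y \<Longrightarrow> ev (Bin Div a b) = x div y"
  by simp

lemma ev_Mod: "ev a = x \<Longrightarrow> ev b = y \<Longrightarrow> ev (Bin Mod a b) = x mod y"
  by simp

lemma ev_Pow2: "ev a = x \<Longrightarrow> x < w \<Longrightarrow> ev (Pow2 a) = 2 ^ x"
  using w_ge by (simp add: Pow2_def push_bit_eq_mult take_bit_nat_eq_self)

lemma ev_Read:
  assumes "ev a = x" "ev t = y" "ev d = k" "x + y div w + 1 < 2 ^ w" "k \<le> w"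
  shows "ev (Read a t d) = take_bit k (drop_bit (x * w + y) (bits_val bits))"
proof -
  have w0: "0 < w" using w_ge by simp
  have mask: "ev (Bin Sub (Bin Shl (Lit 1) d) (Lit 1)) = mask k"
  proof (cases "k = w")
    case True
    \<comment> \<open>For \<open>k = w\<close> the shifted \<open>1\<close> is truncated to
      \<open>0\<close>, and subtracting \<open>1\<close> wraps around to the word of ones.\<close>
    have "take_bit w (2 ^ w + 2 ^ w - 1 - 2 ^ w) = (2 ^ w - 1 :: nat)"
      by (simp add: take_bit_nat_eq_self)
    then show ?thesis
      using w0 assms(3) True ev_Lit_small[of 1]
      by (simp add: push_bit_eq_mult mask_eq_exp_minus_1 take_bit_nat_eq_self)
  next
    case False
    then have "k < w" using assms(5) by simp
    then have "ev (Bin Shl (Lit 1) d) = 2 ^ k"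
      using ev_Pow2[OF assms(3)] by (simp add: Pow2_def)
    moreover have "ev (Lit 1) = 1" by (rule ev_Lit_small) simp
    ultimately show ?thesis
      using ev_Sub[of "Bin Shl (Lit 1) d" "2 ^ k" "Lit 1" 1] \<open>k < w\<close>
      by (simp add: mask_eq_exp_minus_1 del: eval.simps)
  qed
  let ?A = "Bin Add a (Bin Div t (Var 3))" and ?r = "Bin Mod t (Var 3)"
  have A: "ev ?A = x + y div w"
    using assms ev_Var by (intro ev_Add ev_Div) auto
  have A1: "ev (Bin Add ?A (Lit 1)) = x + y div w + 1"
    using assms ev_Lit_small[of 1] by (intro ev_Add A) auto
  have r: "ev ?r = y mod w"
    using assms ev_Var by (intro ev_Mod) auto
  have wr: "ev (Bin Sub (Var 3) ?r) = w - y mod w"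
    using w_less w0 by (intro ev_Sub r ev_Var(4)) (auto intro: less_imp_le)
  have "ev (Read a t d) = Bit_Operations.and
      (Bit_Operations.or (drop_bit (y mod w) (take_bit w (drop_bit ((x + y div w) * w) (bits_val bits))))
         (take_bit w (push_bit (w - y mod w)
            (take_bit w (drop_bit ((x + y div w + 1) * w) (bits_val bits))))))
      (mask k)"
    unfolding Read_def Let_def eval.simps(3)[of _ _ _ And] eval.simps(3)[of _ _ _ Or]
      eval.simps(3)[of _ _ _ Shr] eval.simps(3)[of _ _ _ Shl _ "Bin Sub (Var 3) ?r"] mask
      eval.simps(4) A A1 r wr binop_val.simps pack_eq ..
  also have "\<dots> = take_bit k (drop_bit ((x + y div w) * w + y mod w) (bits_val bits))"
    using w0 assms(5) by (intro word_pair) simp_all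
  also have "(x + y div w) * w + y mod w = x * w + y"
    by (simp add: algebra_simps)
  finally show ?thesis .
qed

lemma ev_Read_field:
  assumes "ev a = x" "ev t = y" "ev d = k" "x + y div w + 1 < 2 ^ w" "k \<le> w"
    and "occurs_at bits (x * w + y) (nat_bits k v)" "v < 2 ^ k"
  shows "ev (Read a t d) = v"
  using ev_Read[OF assms(1-5)] read_field[OF assms(6,7)] by simp

end

section \<open>Coding increasing sequences in blocks\<close>

text \<open>An arbitrary bijection is good enough: decoding is done by table lookup, never by
  computation.\<close>

definition subset_enum :: "nat \<Rightarrow> nat \<Rightarrow> nat \<Rightarrow> nat set" where
  "subset_enum t b =
     (SOME h. bij_betw h {0..<t choose b} {A. A \<subseteq> {..<t} \<and> card A = b})"

lemma bij_betw_subset_enum: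
  "bij_betw (subset_enum t b) {0..<t choose b} {A. A \<subseteq> {..<t} \<and> card A = b}"
proof -
  have "finite {A. A \<subseteq> {..<t} \<and> card A = b}" by simp
  moreover have "card {A. A \<subseteq> {..<t} \<and> card A = b} = t choose b"
    using n_subsets[of "{..<t}" b] by simp
  ultimately show ?thesis
    unfolding subset_enum_def using ex_bij_betw_nat_finite by (metis (mono_tags, lifting) someI_ex)
qed

definition code_len :: "nat \<Rightarrow> nat \<Rightarrow> nat" where
  "code_len t b = (LEAST l. t choose b \<le> 2 ^ l)"

lemma choose_le_code_len: "t choose b \<le> 2 ^ code_len t b"
  unfolding code_len_def by (rule LeastI[of _ "t choose b"]) (simp add: less_imp_le)

lemma code_len_le: "t choose b \<le> 2 ^ l \<Longrightarrow> code_len t b \<le> l"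
  unfolding code_len_def by (rule Least_le)

text \<open>Rounding the code length up costs less than a factor of 2; this is the one bit charged
  per block.\<close>

lemma code_len_tight:
  assumes "b \<le> t"
  shows "2 ^ code_len t b \<le> 2 * (t choose b)"
proof (cases "code_len t b")
  case 0
  then show ?thesis using assms by (simp add: Suc_le_eq)
next
  case (Suc l)
  then have "\<not> t choose b \<le> 2 ^ l"
    using code_len_le[of t b l] by auto
  then show ?thesis using Suc by simp
qed

text \<open>The left side is a single summand of Vandermonde's identity.\<close>

lemma choose_mult_le: "(a choose s) * (t choose b) \<le> (a + t) choose (s + b)"
proof -
  have "(a choose s) * (t choose b) = (a choose s) * (t choose (s + b - s))" by simp
  also have "\<dots> \<le> (\<Sum>k\<le>s + b. (a choose k) * (t choose (s + b - k)))"
    by (rule member_le_sum) auto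
  finally show ?thesis by (simp add: vandermonde)
qed

text \<open>A superblock has \<open>B\<close> blocks of \<open>b0\<close> elements;
  \<open>\<tau>\<close> is the largest extent that is still coded. Local fields have
  \<open>\<gamma>\<close> bits, a block code fits into \<open>\<delta>\<close> bits, and absolute
  values are stored in \<open>g\<close> bits.\<close>

locale block_seq =
  fixes z :: "nat \<Rightarrow> nat" and n U b0 B \<tau> \<gamma> \<delta> g :: nat
  assumes z_mono: "\<And>i j. i < j \<Longrightarrow> j < n \<Longrightarrow> z i < z j"
    and z_less: "\<And>i. i < n \<Longrightarrow> z i < U"
    and b0_pos: "0 < b0" and B_pos: "0 < B"
    and \<tau>_pos: "0 < \<tau>" and \<tau>_pow: "\<tau> ^ b0 \<le> 2 ^ \<delta>" and \<tau>_less: "\<tau> < 2 ^ \<gamma>"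
    and \<gamma>_large: "3 * \<gamma> * B + B * \<delta> < 2 ^ \<gamma>"
begin

definition b1 :: nat where "b1 = b0 * B"

definition extent :: "nat \<Rightarrow> nat \<Rightarrow> nat" where
  "extent s b = z (s + b - 1) - z s + 1"

definition block_set :: "nat \<Rightarrow> nat set" where
  "block_set s = (\<lambda>k. z (s + k) - z s) ` {..<b0}"

definition block_index :: "nat \<Rightarrow> nat" where
  "block_index s =
     (SOME c. c < (extent s b0 choose b0) \<and> subset_enum (extent s b0) b0 c = block_set s)"

definition block_len :: "nat \<Rightarrow> nat" where
  "block_len s = code_len (extent s b0) b0"

definition block_start :: "nat \<Rightarrow> nat \<Rightarrow> nat" where
  "block_start j b = j * b1 + b * b0"

definition block_code :: "nat \<Rightarrow> bool list" where
  "block_code s = nat_bits (block_len s) (block_index s)"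

text \<open>The first alternative sends the incomplete last superblock to verbatim storage, so a
  coded superblock always consists of \<open>B\<close> full blocks.\<close>

definition escaped :: "nat \<Rightarrow> bool" where
  "escaped j \<longleftrightarrow> n < (j + 1) * b1 \<or> \<tau> < extent (j * b1) b1"

text \<open>Measured from the start of the superblock: its \<open>B\<close> records of three fields
  precede the codes.\<close>

definition code_offset :: "nat \<Rightarrow> nat \<Rightarrow> nat" where
  "code_offset j b = 3 * \<gamma> * B + (\<Sum>b'<b. block_len (block_start j b'))"

definition block_record :: "nat \<Rightarrow> nat \<Rightarrow> bool list" where
  "block_record j b = nat_bits \<gamma> (code_offset j b) @
     nat_bits \<gamma> (z (block_start j b) - z (j * b1)) @ nat_bits \<gamma> (extent (block_start j b) b0)"

definition superblock :: "nat \<Rightarrow> bool list" where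
  "superblock j =
     (if escaped j then concat (map (\<lambda>k. nat_bits g (z (j * b1 + k))) [0..<min b1 (n - j * b1)])
      else concat (map (block_record j) [0..<B]) @
           concat (map (\<lambda>b. block_code (block_start j b)) [0..<B]))"

text \<open>The table is indexed by the extent of a block, a window of \<open>\<delta>\<close> bits that starts with its code
  but may continue with unrelated bits, and the position within the block. Hence the program need not
  know the length of the code.\<close>

definition table_entry :: "nat \<Rightarrow> nat" where
  "table_entry k =
     (let t = k div b0 div 2 ^ \<delta>; c = k div b0 mod 2 ^ \<delta> mod 2 ^ code_len t b0 in
      sorted_list_of_set (subset_enum t b0 c) ! (k mod b0))"

section \<open>Correctness of the block code\<close>

lemma b1_pos: "0 < b1" using b0_pos B_pos by (simp add: b1_def)

lemma z_mono_le: "i \<le> j \<Longrightarrow> j < n \<Longrightarrow> z i \<le> z j"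
  using z_mono by (cases "i = j") (auto intro: less_imp_le)

lemma extent_ge:
  assumes "s + b \<le> n"
  shows "b \<le> extent s b"
proof -
  have "k \<le> z (s + k) - z s" if "s + k < n" for k
    using that
  proof (induction k)
    case (Suc k)
    then have "z (s + k) < z (s + Suc k)" "z s \<le> z (s + k)"
      using z_mono[of "s + k" "s + Suc k"] z_mono_le[of s "s + k"] by auto
    then show ?case using Suc by auto
  qed simp
  from this[of "b - 1"] show ?thesis
    using assms by (cases b) (auto simp: extent_def)
qed

lemma block_set_in:
  assumes "s + b0 \<le> n"
  shows "block_set s \<subseteq> {..<extent s b0}" "card (block_set s) = b0"
    and "sorted_list_of_set (block_set s) = map (\<lambda>k. z (s + k) - z s) [0..<b0]"
proof -
  have st: "z (s + k) - z s < z (s + l) - z s" if "k < l" "l < b0" for k l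
    using that assms z_mono[of "s + k" "s + l"] z_mono_le[of s "s + k"] by auto
  show "block_set s \<subseteq> {..<extent s b0}"
  proof -
    have "z (s + k) \<le> z (s + b0 - 1)" if "k < b0" for k
      using that assms by (intro z_mono_le) auto
    then show ?thesis by (auto simp: block_set_def extent_def le_imp_less_Suc diff_le_mono)
  qed
  have "strict_mono_on {..<b0} (\<lambda>k. z (s + k) - z s)"
    using st by (auto simp: strict_mono_on_def)
  then show "card (block_set s) = b0"
    unfolding block_set_def by (subst card_image) (auto dest: strict_mono_on_imp_inj_on)
  have "sorted_wrt (<) (map (\<lambda>k. z (s + k) - z s) [0..<b0])"
    using st by (auto simp: sorted_wrt_iff_nth_less)
  moreover have "set (map (\<lambda>k. z (s + k) - z s) [0..<b0]) = block_set s"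
    by (auto simp: block_set_def atLeast0LessThan)
  ultimately show "sorted_list_of_set (block_set s) = map (\<lambda>k. z (s + k) - z s) [0..<b0]"
    using sorted_list_of_set.idem_if_sorted_distinct strict_sorted_iff by metis
qed

lemma block_index:
  assumes "s + b0 \<le> n"
  shows "block_index s < 2 ^ block_len s"
    and "subset_enum (extent s b0) b0 (block_index s) = block_set s"
proof -
  have "block_set s \<in> subset_enum (extent s b0) b0 ` {0..<extent s b0 choose b0}"
    using block_set_in[OF assms] bij_betw_subset_enum[of "extent s b0" b0]
    by (auto simp: bij_betw_def)
  then have "\<exists>c. c < (extent s b0 choose b0) \<and> subset_enum (extent s b0) b0 c = block_set s"
    by auto
  from someI_ex[OF this]
  have *: "block_index s < (extent s b0 choose b0)"
    "subset_enum (extent s b0) b0 (block_index s) = block_set s"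
    unfolding block_index_def by auto
  then show "subset_enum (extent s b0) b0 (block_index s) = block_set s" by simp
  show "block_index s < 2 ^ block_len s"
    using * choose_le_code_len[of "extent s b0" b0] unfolding block_len_def by linarith
qed

text \<open>Only the low \<open>block_len s\<close> bits of \<open>c\<close> are constrained, since
  the higher ones are whatever follows the code in memory.\<close>

lemma table_entry_correct:
  assumes "s + b0 \<le> n" "c < 2 ^ \<delta>" "c mod 2 ^ block_len s = block_index s" "k < b0"
  shows "table_entry ((extent s b0 * 2 ^ \<delta> + c) * b0 + k) = z (s + k) - z s"
proof -
  have 1: "((extent s b0 * 2 ^ \<delta> + c) * b0 + k) div b0 = extent s b0 * 2 ^ \<delta> + c"
    "((extent s b0 * 2 ^ \<delta> + c) * b0 + k) mod b0 = k"
    using assms(4) by simp_all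
  have 2: "(extent s b0 * 2 ^ \<delta> + c) div 2 ^ \<delta> = extent s b0" "(extent s b0 * 2 ^ \<delta> + c) mod 2 ^ \<delta> = c"
    using assms(2) by simp_all
  show ?thesis
    using assms(3,4) block_index(2)[OF assms(1)] block_set_in(3)[OF assms(1)]
    unfolding table_entry_def Let_def 1 2 block_len_def by simp
qed

text \<open>The blocks lie inside a superblock of extent at most \<open>\<tau>\<close> and inherit
  that bound, so all their data fit the fixed local widths.\<close>

lemma not_escapedD:
  assumes "\<not> escaped j" "b < B"
  shows "block_start j b + b0 \<le> n" and "extent (block_start j b) b0 \<le> \<tau>"
    and "z (block_start j b) - z (j * b1) < \<tau>" and "z (j * b1) \<le> z (block_start j b)"
    and "block_len (block_start j b) \<le> \<delta>" and "code_offset j b < 2 ^ \<gamma>"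
proof -
  have fit: "block_start j b' + b0 \<le> (j + 1) * b1" if "b' < B" for b'
  proof -
    have "b' * b0 + b0 \<le> B * b0" using that by (metis add.commute mult_Suc Suc_leI mult_le_mono1)
    then show ?thesis by (simp add: block_start_def b1_def algebra_simps)
  qed
  have n: "(j + 1) * b1 \<le> n" and ext: "extent (j * b1) b1 \<le> \<tau>"
    using assms by (auto simp: escaped_def)
  have fitn: "block_start j b' + b0 \<le> n" if "b' < B" for b'
    using fit[OF that] n by linarith
  show "block_start j b + b0 \<le> n" using fitn assms(2) .
  have last: "z (block_start j b' + b0 - 1) \<le> z (j * b1 + b1 - 1)" if "b' < B" for b'
    using fit[OF that] n b1_pos b0_pos by (intro z_mono_le) auto
  have first: "z (j * b1) \<le> z (block_start j b')" if "b' < B" for b'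
    using fitn[OF that] b0_pos by (intro z_mono_le) (auto simp: block_start_def)
  have mid: "z (block_start j b') \<le> z (block_start j b' + b0 - 1)" if "b' < B" for b'
    using fitn[OF that] b0_pos by (intro z_mono_le) auto
  have e: "extent (block_start j b') b0 \<le> \<tau>" if "b' < B" for b'
    using last[OF that] first[OF that] mid[OF that] ext unfolding extent_def by linarith
  show "extent (block_start j b) b0 \<le> \<tau>" using e assms(2) .
  show "z (block_start j b) - z (j * b1) < \<tau>"
    using last[OF assms(2)] first[OF assms(2)] mid[OF assms(2)] ext unfolding extent_def by linarith
  show "z (j * b1) \<le> z (block_start j b)" using first assms(2) .
  have len: "block_len (block_start j b') \<le> \<delta>" if "b' < B" for b'
    unfolding block_len_def
  proof (rule code_len_le)
    have "(extent (block_start j b') b0 choose b0) \<le> extent (block_start j b') b0 ^ b0"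
      by (rule binomial_le_pow) (rule extent_ge[OF fitn[OF that]])
    also have "\<dots> \<le> \<tau> ^ b0" using e[OF that] by (rule power_mono) simp
    finally show "(extent (block_start j b') b0 choose b0) \<le> 2 ^ \<delta>" using \<tau>_pow by linarith
  qed
  then show "block_len (block_start j b) \<le> \<delta>" using assms(2) .
  have "(\<Sum>b'<b. block_len (block_start j b')) \<le> (\<Sum>b'<b. \<delta>)"
    using len assms(2) by (intro sum_mono) auto
  also have "\<dots> \<le> B * \<delta>" using assms(2) by simp
  finally show "code_offset j b < 2 ^ \<gamma>" using \<gamma>_large by (simp add: code_offset_def)
qed

text \<open>The length of the initial piece of the universe occupied by the first \<open>s\<close>
  elements. It drives the induction that merges blocks from the left; gaps between blocks turn the
  step into an inequality.\<close>

definition upto_last :: "nat \<Rightarrow> nat" where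
  "upto_last s = (if s = 0 then 0 else z (s - 1) + 1)"

lemma upto_last_step:
  assumes "s + b \<le> n" "0 < b"
  shows "upto_last s + extent s b \<le> upto_last (s + b)"
proof -
  have "upto_last s \<le> z s"
    using assms z_mono[of "s - 1" s] by (auto simp: upto_last_def Suc_le_eq)
  moreover have "z s \<le> z (s + b - 1)" using assms by (intro z_mono_le) auto
  ultimately show ?thesis using assms by (simp add: upto_last_def extent_def)
qed

lemma upto_last_le: "s \<le> n \<Longrightarrow> upto_last s \<le> U"
  using z_less[of "s - 1"] by (cases s) (auto simp: upto_last_def Suc_le_eq)

lemma prod_choose_le_aux:
  assumes "K * b0 \<le> n"
  shows "(\<Prod>k<K. extent (k * b0) b0 choose b0) \<le> upto_last (K * b0) choose (K * b0)"
  using assms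
proof (induction K)
  case (Suc K)
  have *: "K * b0 + b0 \<le> n" using Suc.prems by (simp add: add.commute)
  have "(\<Prod>k<Suc K. extent (k * b0) b0 choose b0)
      \<le> (upto_last (K * b0) choose (K * b0)) * (extent (K * b0) b0 choose b0)"
    using Suc.IH * by simp
  also have "\<dots> \<le> (upto_last (K * b0) + extent (K * b0) b0) choose (K * b0 + b0)"
    by (rule choose_mult_le)
  also have "\<dots> \<le> upto_last (K * b0 + b0) choose (K * b0 + b0)"
    using upto_last_step[OF * b0_pos] by (rule binomial_right_mono)
  finally show ?case by (simp add: add.commute)
qed simp

text \<open>Binomial coefficients are not monotone in the lower argument, so the elements from
  \<open>s\<close> on are merged as one further block, whose number of sets is at least 1.\<close>

lemma choose_upto_last_le:
  assumes "s \<le> n"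
  shows "upto_last s choose s \<le> U choose n"
proof (cases "s = n")
  case True
  then show ?thesis using upto_last_le binomial_right_mono by auto
next
  case False
  define b where "b = n - s"
  have b: "s + b = n" "0 < b" using False assms by (auto simp: b_def)
  have "1 \<le> extent s b choose b" using extent_ge[of s b] b by (simp add: Suc_le_eq)
  then have "upto_last s choose s \<le> (upto_last s choose s) * (extent s b choose b)" by simp
  also have "\<dots> \<le> (upto_last s + extent s b) choose (s + b)" by (rule choose_mult_le)
  also have "\<dots> \<le> U choose (s + b)"
    using upto_last_step[of s b] upto_last_le[of n] b by (intro binomial_right_mono) auto
  finally show ?thesis using b by simp
qed

text \<open>The bound on the code lengths in exponential form, which stays within the natural
  numbers; \<open>2 ^ (n div b0)\<close> collects the rounding.\<close>

lemma sum_block_len_le: "2 ^ (\<Sum>k<n div b0. block_len (k * b0)) \<le> 2 ^ (n div b0) * (U choose n)"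
proof -
  have le: "k * b0 + b0 \<le> n" if "k < n div b0" for k
  proof -
    have "(k + 1) * b0 \<le> n div b0 * b0" using that by (intro mult_le_mono1) simp
    also have "\<dots> \<le> n" by simp
    finally show ?thesis by simp
  qed
  have "2 ^ (\<Sum>k<n div b0. block_len (k * b0)) = (\<Prod>k<n div b0. 2 ^ block_len (k * b0) :: nat)"
    by (simp add: power_sum)
  also have "\<dots> \<le> (\<Prod>k<n div b0. 2 * (extent (k * b0) b0 choose b0))"
    using le extent_ge unfolding block_len_def by (intro prod_mono conjI code_len_tight) auto
  also have "\<dots> = 2 ^ (n div b0) * (\<Prod>k<n div b0. extent (k * b0) b0 choose b0)"
    by (simp add: prod.distrib)
  also have "\<dots> \<le> 2 ^ (n div b0) * (upto_last (n div b0 * b0) choose (n div b0 * b0))"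
    by (intro mult_le_mono2 prod_choose_le_aux) simp
  also have "\<dots> \<le> 2 ^ (n div b0) * (U choose n)"
    by (intro mult_le_mono2 choose_upto_last_le) simp
  finally show ?thesis .
qed

lemma sum_extent_le:
  assumes "J * b1 \<le> n"
  shows "(\<Sum>j<J. extent (j * b1) b1) \<le> upto_last (J * b1)"
  using assms
proof (induction J)
  case (Suc J)
  then show ?case using upto_last_step[of "J * b1" b1] b1_pos by (simp add: add.commute)
qed simp

text \<open>Superblocks occupy disjoint pieces of the universe, so at most
  \<open>U div \<tau>\<close> of them are longer than \<open>\<tau>\<close>. The extra 1 is the
  incomplete, possibly empty, last superblock.\<close>

lemma escaped_count:
  "card {j. j < n div b1 + 1 \<and> escaped j} \<le> U div \<tau> + 1"
proof -
  let ?E = "{j. j < n div b1 \<and> \<tau> < extent (j * b1) b1}"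
  have "card ?E * \<tau> = (\<Sum>j\<in>?E. \<tau>)" by simp
  also have "\<dots> \<le> (\<Sum>j\<in>?E. extent (j * b1) b1)" by (intro sum_mono) auto
  also have "\<dots> \<le> (\<Sum>j<n div b1. extent (j * b1) b1)" by (intro sum_mono2) auto
  also have "\<dots> \<le> upto_last (n div b1 * b1)" by (rule sum_extent_le) simp
  also have "\<dots> \<le> U" by (rule upto_last_le) simp
  finally have E: "card ?E \<le> U div \<tau>" using \<tau>_pos by (simp add: less_eq_div_iff_mult_less_eq)
  have full: "(j + 1) * b1 \<le> n" if "j < n div b1" for j
  proof -
    have "(j + 1) * b1 \<le> n div b1 * b1" using that by (intro mult_le_mono1) simp
    also have "\<dots> \<le> n" by simp
    finally show ?thesis .
  qed
  have "{j. j < n div b1 + 1 \<and> escaped j} \<subseteq> insert (n div b1) ?E"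
    using full by (force simp: escaped_def less_Suc_eq)
  then have "card {j. j < n div b1 + 1 \<and> escaped j} \<le> card (insert (n div b1) ?E)"
    by (intro card_mono) auto
  also have "\<dots> \<le> card ?E + 1" by (simp add: card_insert_le_m1)
  finally show ?thesis using E by linarith
qed

lemma length_superblock_le:
  "length (superblock j) \<le> (if escaped j then b1 * g else 0) + 3 * \<gamma> * B +
     (if (j + 1) * b1 \<le> n then \<Sum>b<B. block_len (block_start j b) else 0)"
proof (cases "escaped j")
  case True
  have "length (superblock j) = min b1 (n - j * b1) * g"
    using True by (simp add: superblock_def length_concat_map)
  also have "\<dots> \<le> b1 * g" by simp
  finally show ?thesis using True by simp
next
  case False
  then have "(j + 1) * b1 \<le> n" by (auto simp: escaped_def)
  then show ?thesis
    using False by (simp add: superblock_def length_concat_map block_record_def block_code_def)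
qed

lemma sum_blocks: "(\<Sum>j<J. \<Sum>b<B. f (block_start j b)) = (\<Sum>k<J * B. f (k * b0))"
proof -
  have "(\<Sum>b<B. f (block_start j b)) = (\<Sum>k\<in>{j * B..<j * B + B}. f (k * b0))" for j
    by (rule sum.reindex_bij_witness[of _ "\<lambda>k. k - j * B" "\<lambda>b. j * B + b"])
      (auto simp: block_start_def b1_def algebra_simps)
  then show ?thesis by (simp add: sum.nat_group)
qed

lemma sum_length_superblock_le:
  "(\<Sum>j<n div b1 + 1. length (superblock j)) \<le>
     (U div \<tau> + 1) * (b1 * g) + (n div b1 + 1) * (3 * \<gamma> * B) + (\<Sum>k<n div b0. block_len (k * b0))"
proof -
  let ?J = "n div b1 + 1"
  have "(\<Sum>j<?J. length (superblock j)) \<le> (\<Sum>j<?J. (if escaped j then b1 * g else 0) + 3 * \<gamma> * B +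
     (if (j + 1) * b1 \<le> n then \<Sum>b<B. block_len (block_start j b) else 0))"
    by (rule sum_mono) (rule length_superblock_le)
  also have "\<dots> = (\<Sum>j<?J. if escaped j then b1 * g else 0) + ?J * (3 * \<gamma> * B) +
     (\<Sum>j<?J. if (j + 1) * b1 \<le> n then \<Sum>b<B. block_len (block_start j b) else 0)"
    by (simp only: sum.distrib sum_constant card_lessThan of_nat_id)
  also have "(\<Sum>j<?J. if escaped j then b1 * g else 0) = card {j. j < ?J \<and> escaped j} * (b1 * g)"
    by (subst sum.inter_filter[symmetric]) (auto intro!: arg_cong[where f = card])
  also have "\<dots> \<le> (U div \<tau> + 1) * (b1 * g)"
    by (intro mult_le_mono1 escaped_count)
  \<comment> \<open>The last superblock is never full and drops out. Full escaped superblocks are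
    charged for codes as well, so that the bound on all blocks applies.\<close>
  also have "(\<Sum>j<?J. if (j + 1) * b1 \<le> n then \<Sum>b<B. block_len (block_start j b) else 0)
      \<le> (\<Sum>j<n div b1. \<Sum>b<B. block_len (block_start j b))"
  proof -
    have "\<not> (n div b1 + 1) * b1 \<le> n"
      using b1_pos by (metis add.commute dividend_less_div_times linorder_not_less mult_Suc plus_1_eq_Suc)
    then show ?thesis by (auto intro!: sum_mono)
  qed
  also have "\<dots> = (\<Sum>k<n div b1 * B. block_len (k * b0))" by (rule sum_blocks)
  also have "\<dots> \<le> (\<Sum>k<n div b0. block_len (k * b0))"
  proof (rule sum_mono2)
    have "n div b1 * B \<le> n div b0"
      using b0_pos by (simp add: b1_def div_mult2_eq)
    then show "{..<n div b1 * B} \<subseteq> {..<n div b0}" by auto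
  qed auto
  finally show ?thesis by (auto intro: add_mono)
qed

end

section \<open>Parameters\<close>

text \<open>The floor of \<open>lg n\<close> plus 1 for positive \<open>n\<close>, and 0 for
  \<open>n = 0\<close>.\<close>

definition bit_length :: "nat \<Rightarrow> nat" where
  "bit_length n = (LEAST l. n < 2 ^ l)"

lemma less_two_power_bit_length: "n < 2 ^ bit_length n"
  unfolding bit_length_def by (rule LeastI[of _ n]) simp

lemma bit_length_le: "n < 2 ^ l \<Longrightarrow> bit_length n \<le> l"
  unfolding bit_length_def by (rule Least_le)

lemma bit_length_pos: "1 \<le> n \<Longrightarrow> 1 \<le> bit_length n"
  using less_two_power_bit_length[of n] by (cases "bit_length n") auto

lemma two_power_bit_length_le: "1 \<le> n \<Longrightarrow> 2 ^ bit_length n \<le> 2 * n"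
  using bit_length_le[of n "bit_length n - 1"] bit_length_pos[of n]
  by (cases "bit_length n") (auto simp: not_less[symmetric])

lemma bit_length_real:
  assumes "1 \<le> n"
  shows "log 2 (real n) \<le> real (bit_length n)" "real (bit_length n) \<le> log 2 (real n) + 1"
proof -
  have "real n < 2 ^ bit_length n"
    using less_two_power_bit_length[of n] by (metis of_nat_less_iff of_nat_numeral of_nat_power)
  then show "log 2 (real n) \<le> real (bit_length n)"
    using assms by (simp add: less_imp_le log_le_iff powr_realpow)
  have "2 ^ bit_length n \<le> 2 * real n"
    using two_power_bit_length_le[OF assms]
    by (metis of_nat_le_iff of_nat_mult of_nat_numeral of_nat_power)
  then have "real (bit_length n) \<le> log 2 (2 * real n)"
    using assms by (simp add: le_log_iff powr_realpow)
  then show "real (bit_length n) \<le> log 2 (real n) + 1"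
    using assms by (simp add: log_mult)
qed

text \<open>With \<open>L = bit_length n\<close> about \<open>lg n\<close> and \<open>e = level n\<close> about \<open>lg (lg n)\<close>: a block has \<open>e\<^sup>2\<close>
  elements and a superblock \<open>L\<^sup>2\<close> blocks; a superblock that stretches over more than \<open>L ^ 5\<close> values is
  stored verbatim, so that quantities local to the others fit into \<open>10 e\<close> bits and the code of a
  block into \<open>5 e ^ 3\<close> bits; absolute quantities fit into \<open>3 L + K\<close> bits.\<close>

definition level :: "nat \<Rightarrow> nat" where "level n = bit_length (bit_length n)"
definition field_width :: "nat \<Rightarrow> nat" where "field_width n = 10 * level n"
definition block_size :: "nat \<Rightarrow> nat" where "block_size n = level n * level n"
definition block_count :: "nat \<Rightarrow> nat" where "block_count n = bit_length n * bit_length n"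
definition window_width :: "nat \<Rightarrow> nat" where "window_width n = 5 * (level n * level n * level n)"
definition extent_bound :: "nat \<Rightarrow> nat" where "extent_bound n = bit_length n ^ 5"
definition super_size :: "nat \<Rightarrow> nat" where "super_size n = block_size n * block_count n"
definition ptr_width :: "nat \<Rightarrow> nat \<Rightarrow> nat" where "ptr_width K n = 3 * bit_length n + K"

text \<open>The summands are the header, the directory with four fields per superblock, and the
  decoding table.\<close>

definition index_size :: "nat \<Rightarrow> nat \<Rightarrow> nat" where
  "index_size K n = 3 * level n + 1 + 3 * ptr_width K n + (n div super_size n + 1) * (4 * ptr_width K n) +
     2 ^ field_width n * 2 ^ window_width n * block_size n * field_width n"

text \<open>The summands are the escaped superblocks, with \<open>6 * n * bit_length n\<close> as a
  bound for the universe, the block records, and a rounding bit per block.\<close>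

definition data_excess :: "nat \<Rightarrow> nat \<Rightarrow> nat" where
  "data_excess K n = (6 * n * bit_length n div extent_bound n + 1) * (super_size n * ptr_width K n) +
     (n div super_size n + 1) * (3 * field_width n * block_count n) + n div block_size n"

definition overhead :: "nat \<Rightarrow> nat \<Rightarrow> nat" where
  "overhead K n = index_size K n + data_excess K n"

section \<open>Bounds on widths and asymptotics of the overhead\<close>

lemma level_pos: "1 \<le> n \<Longrightarrow> 1 \<le> level n"
  unfolding level_def by (intro bit_length_pos)

lemma bit_length_less: "bit_length n < 2 ^ level n"
  by (simp add: level_def less_two_power_bit_length)

lemma extent_bound_pow: "extent_bound n ^ block_size n \<le> 2 ^ window_width n"
proof -
  have "extent_bound n ^ block_size n \<le> ((2 ^ level n) ^ 5) ^ block_size n"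
    unfolding extent_bound_def using bit_length_less[of n] by (intro power_mono) auto
  also have "\<dots> = 2 ^ (level n * 5 * block_size n)" by (simp only: power_mult)
  also have "level n * 5 * block_size n = window_width n" by (simp add: window_width_def block_size_def)
  finally show ?thesis .
qed

lemma extent_bound_less: "1 \<le> n \<Longrightarrow> extent_bound n < 2 ^ field_width n"
proof -
  assume n: "1 \<le> n"
  have "extent_bound n < (2 ^ level n) ^ 5"
    unfolding extent_bound_def using bit_length_less[of n] by (intro power_strict_mono) auto
  also have "\<dots> = 2 ^ (level n * 5)" by (simp only: power_mult)
  also have "\<dots> \<le> 2 ^ field_width n" by (rule power_increasing) (auto simp: field_width_def)
  finally show ?thesis .
qed

lemma le_two_power_pred: "1 \<le> (e::nat) \<Longrightarrow> 2 * e \<le> 2 ^ e"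
  by (induction e rule: nat_induct_at_least) auto

text \<open>The source of the constant 10: with \<open>e = level n\<close>, the factor
  \<open>block_count n\<close> is below \<open>2 ^ (2 * e)\<close>, and
  \<open>40 * e ^ 3 = 5 * (2 * e) ^ 3\<close> is at most
  \<open>2 ^ (5 * e) * 2 ^ (3 * e)\<close>.\<close>

lemma field_width_large:
  assumes "1 \<le> n"
  shows "3 * field_width n * block_count n + block_count n * window_width n < 2 ^ field_width n"
proof -
  define e where "e = level n"
  have e: "1 \<le> e" using level_pos[OF assms] by (simp add: e_def)
  have "3 * field_width n * block_count n + block_count n * window_width n = block_count n * (30 * e + 5 * (e * e * e))"
    by (simp add: field_width_def window_width_def e_def algebra_simps)
  also have "\<dots> \<le> block_count n * (35 * (e * e * e))"
    using e by (intro mult_le_mono2) simp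
  also have "\<dots> < (2 ^ e * 2 ^ e) * (35 * (e * e * e))"
  proof (rule mult_strict_right_mono)
    show "block_count n < 2 ^ e * 2 ^ e"
      unfolding block_count_def e_def using bit_length_less[of n] by (intro mult_strict_mono) auto
  qed (use e in auto)
  also have "\<dots> \<le> 2 ^ e * 2 ^ e * (40 * (e * e * e))" by simp
  also have "\<dots> = 2 ^ e * 2 ^ e * (5 * ((2 * e) * (2 * e) * (2 * e)))" by simp
  also have "\<dots> \<le> 2 ^ e * 2 ^ e * ((2 ^ e * 2 ^ e * 2 ^ e * 2 ^ e * 2 ^ e) * (2 ^ e * 2 ^ e * 2 ^ e))"
  proof (intro mult_le_mono2 mult_le_mono le_two_power_pred e)
    have "(5::nat) \<le> 2 ^ 5" by simp
    also have "\<dots> \<le> 2 ^ (e * 5)" by (rule power_increasing) (use e in auto)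
    also have "\<dots> = 2 ^ e * 2 ^ e * 2 ^ e * 2 ^ e * 2 ^ e"
      by (simp flip: power_add)
    finally show "5 \<le> (2::nat) ^ e * 2 ^ e * 2 ^ e * 2 ^ e * 2 ^ e" .
  qed
  also have "\<dots> = 2 ^ (e * 10)"
    by (simp flip: power_add)
  finally show ?thesis by (simp add: field_width_def e_def mult.commute)
qed

text \<open>\<open>K\<close> enters through \<open>ptr_width\<close> only, hence linearly. The
  asymptotics reduce to \<open>K = 0\<close>, and a later choice of \<open>K\<close> can rely on
  \<open>2 ^ K\<close> outgrowing this factor.\<close>

lemma overhead_le: "1 \<le> n \<Longrightarrow> overhead K n \<le> (1 + K) * overhead 0 n"
proof -
  assume n: "1 \<le> n"
  have w: "ptr_width K n \<le> (1 + K) * ptr_width 0 n"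
    using bit_length_pos[OF n] by (simp add: ptr_width_def algebra_simps)
  have a: "a * (b * ptr_width K n) \<le> (1 + K) * (a * (b * ptr_width 0 n))" for a b
    using mult_le_mono2[OF w, of "a * b"] by (simp only: ac_simps)
  have "3 * ptr_width K n \<le> (1 + K) * (3 * ptr_width 0 n)" using a[of 1 3] by simp
  moreover have "(n div super_size n + 1) * (4 * ptr_width K n) \<le> (1 + K) * ((n div super_size n + 1) * (4 * ptr_width 0 n))"
    by (rule a)
  moreover have "(6 * n * bit_length n div extent_bound n + 1) * (super_size n * ptr_width K n)
      \<le> (1 + K) * ((6 * n * bit_length n div extent_bound n + 1) * (super_size n * ptr_width 0 n))"
    by (rule a)
  moreover have "3 * level n + 1 \<le> (1 + K) * (3 * level n + 1)"
    "2 ^ field_width n * 2 ^ window_width n * block_size n * field_width n \<le> (1 + K) * (2 ^ field_width n * 2 ^ window_width n * block_size n * field_width n)"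
    "(n div super_size n + 1) * (3 * field_width n * block_count n) \<le> (1 + K) * ((n div super_size n + 1) * (3 * field_width n * block_count n))"
    "n div block_size n \<le> (1 + K) * (n div block_size n)"
    by simp_all
  ultimately show ?thesis
    unfolding overhead_def index_size_def data_excess_def distrib_left by linarith
qed

text \<open>A smooth majorant of \<open>overhead 0\<close>, with \<open>bit_length n\<close>
  enclosed by \<open>x\<close> and \<open>x + 1\<close> and \<open>level n\<close> by
  \<open>lo\<close> and \<open>hi\<close>. The power of 2 is the table.\<close>

lemma overhead_bound_smallo:
  "(\<lambda>n::nat. let x = log 2 (real n); lo = log 2 x; hi = log 2 (x + 1) + 1 in
     13 * (x + 1) + (12 * n / x + 12 * (x + 1)) + 2 powr (22 * hi ^ 3) +
     (18 * n * hi ^ 2 / x + 3 * hi ^ 2 * (x + 1) ^ 3) + (30 * n / lo + 30 * hi * (x + 1) ^ 2) +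
     n / lo ^ 2) \<in> o(\<lambda>n. real n)"
  unfolding Let_def by real_asymp

lemma overhead_0_smallo: "(\<lambda>n. real (overhead 0 n)) \<in> o(\<lambda>n. real n)"
proof (rule landau_o.big_small_trans[OF bigoI overhead_bound_smallo])
  show "eventually (\<lambda>n. norm (real (overhead 0 n)) \<le> 1 * norm (let x = log 2 (real n); lo = log 2 x; hi = log 2 (x + 1) + 1 in
     13 * (x + 1) + (12 * n / x + 12 * (x + 1)) + 2 powr (22 * hi ^ 3) +
     (18 * n * hi ^ 2 / x + 3 * hi ^ 2 * (x + 1) ^ 3) + (30 * n / lo + 30 * hi * (x + 1) ^ 2) +
     n / lo ^ 2)) sequentially"
    \<comment> \<open>From 5 on \<open>x > 2\<close> and \<open>lo > 1\<close>, so all denominators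
      are positive.\<close>
    using eventually_ge_at_top[of 5]
  proof eventually_elim
    case (elim n)
    define x where "x = log 2 (real n)"
    define lo where "lo = log 2 x"
    define hi where "hi = log 2 (x + 1) + 1"
    define L where "L = real (bit_length n)"
    define e where "e = real (level n)"
    have n1: "1 \<le> n" using elim by simp
    have "log 2 4 < x" unfolding x_def using elim by (subst log_less_cancel_iff) auto
    moreover have "log 2 4 = (2::real)" using log_pow_cancel[of 2 2] by simp
    ultimately have x: "2 < x" by simp
    then have "log 2 2 < lo" unfolding lo_def by (subst log_less_cancel_iff) auto
    then have lo: "1 < lo" by simp
    have L: "x \<le> L" "L \<le> x + 1" using bit_length_real[OF n1] by (auto simp: x_def L_def)
    have L1: "1 \<le> bit_length n" using bit_length_pos[OF n1] .
    have e': "log 2 L \<le> e" "e \<le> log 2 L + 1"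
      using bit_length_real[OF L1] by (auto simp: L_def e_def level_def)
    have "lo \<le> log 2 L" "log 2 L \<le> log 2 (x + 1)"
      using L x by (auto simp: lo_def)
    with e' have e: "lo \<le> e" "e \<le> hi" by (auto simp: hi_def)
    have e1: "1 \<le> e" using e lo by simp
    have L2: "2 < L" using L x by simp
    have eL: "e \<le> L" using bit_length_le[of "bit_length n" "bit_length n"] by (simp add: e_def L_def level_def)
    have sup: "real (super_size n) = e\<^sup>2 * L\<^sup>2"
      by (simp add: super_size_def block_size_def block_count_def e_def L_def power2_eq_square)
    have e2: "1 \<le> e\<^sup>2" using e1 by simp
    have divle: "real (a div b) \<le> real a / real b" for a b :: nat by (rule of_nat_div_le_of_nat)
    have ns: "real (n div super_size n) \<le> n / (e\<^sup>2 * L\<^sup>2)" using divle[of n "super_size n"] sup by simp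
    have t1: "3 * e + 1 + 3 * (3 * L) \<le> 13 * (x + 1)" using eL L x by simp
    have t2: "(real (n div super_size n) + 1) * (4 * (3 * L)) \<le> 12 * n / x + 12 * (x + 1)"
    proof -
      have "(real (n div super_size n) + 1) * (12 * L) \<le> (n / (e\<^sup>2 * L\<^sup>2) + 1) * (12 * L)"
        using ns L2 by (intro mult_right_mono) auto
      also have "\<dots> = 12 * n / (e\<^sup>2 * L) + 12 * L" using L2 e1 by (simp add: field_simps power2_eq_square)
      also have "12 * n / (e\<^sup>2 * L) \<le> 12 * n / (1 * x)"
        using e2 L x L2 by (intro divide_left_mono mult_mono mult_pos_pos) auto
      finally show ?thesis using L by simp
    qed
    have t3: "2 ^ field_width n * 2 ^ window_width n * real (block_size n) * real (field_width n) \<le> 2 powr (22 * hi ^ 3)"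
    proof -
      define k where "k = level n"
      have k1: "1 \<le> k" using level_pos[OF n1] by (simp add: k_def)
      have kk: "k \<le> k * k * k" using k1 by simp
      have "2 ^ field_width n * 2 ^ window_width n * block_size n * field_width n = 2 ^ (10 * k + 5 * (k * k * k)) * (10 * (k * k * k))"
        by (simp add: field_width_def window_width_def block_size_def k_def power_add)
      \<comment> \<open>\<open>10 \<le> 2 ^ 4\<close> and \<open>k ^ 3 \<le> 2 ^ (k ^ 3)\<close>
        turn the whole product into a power of 2.\<close>
      also have "\<dots> \<le> 2 ^ (10 * k + 5 * (k * k * k)) * (2 ^ 4 * (2 ^ (k * k * k)))"
        using less_exp[of "k * k * k"] by (intro mult_le_mono mult_mono) (auto intro: less_imp_le)
      also have "\<dots> = 2 ^ (10 * k + 5 * (k * k * k) + (4 + k * k * k))" by (simp only: power_add)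
      also have "\<dots> \<le> 2 ^ (22 * (k * k * k))"
      proof (rule power_increasing)
        show "10 * k + 5 * (k * k * k) + (4 + k * k * k) \<le> 22 * (k * k * k)"
          using kk k1 by linarith
      qed simp
      finally have "real (2 ^ field_width n * 2 ^ window_width n * block_size n * field_width n) \<le> real (2 ^ (22 * (k * k * k)))"
        by (simp only: of_nat_le_iff)
      also have "\<dots> = 2 powr (22 * e ^ 3)"
        by (simp add: k_def e_def power3_eq_cube powr_realpow[symmetric])
      also have "\<dots> \<le> 2 powr (22 * hi ^ 3)"
        using e e1 by (intro powr_mono mult_left_mono power_mono) auto
      finally show ?thesis by simp
    qed
    \<comment> \<open>The exponent 5 of \<open>extent_bound\<close> is chosen here: about
      \<open>6 * n / L ^ 4\<close> escaped superblocks of \<open>e\<^sup>2 * L\<^sup>2\<close>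
      elements at \<open>3 * L\<close> bits each leave
      \<open>18 * n * e\<^sup>2 / L\<close>.\<close>
    have t4: "(real (6 * n * bit_length n div extent_bound n) + 1) * (super_size n * (3 * L))
        \<le> 18 * n * hi ^ 2 / x + 3 * hi ^ 2 * (x + 1) ^ 3"
    proof -
      have "real (6 * n * bit_length n div extent_bound n) \<le> 6 * n * L / L ^ 5"
        using divle[of "6 * n * bit_length n" "extent_bound n"] by (simp add: L_def extent_bound_def)
      then have "(real (6 * n * bit_length n div extent_bound n) + 1) * (super_size n * (3 * L))
          \<le> (6 * n * L / L ^ 5 + 1) * (e\<^sup>2 * L\<^sup>2 * (3 * L))"
        unfolding sup using L2 by (intro mult_right_mono) auto
      also have "\<dots> = 18 * n * e\<^sup>2 / L + 3 * e\<^sup>2 * L ^ 3"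
        using L2 by (simp add: field_simps eval_nat_numeral)
      also have "18 * n * e\<^sup>2 / L \<le> 18 * n * hi ^ 2 / x"
        using e e1 L x by (intro frac_le mult_left_mono power_mono) auto
      also have "3 * e\<^sup>2 * L ^ 3 \<le> 3 * hi ^ 2 * (x + 1) ^ 3"
        using e e1 L L2 by (intro mult_mono mult_left_mono power_mono) auto
      finally show ?thesis by simp
    qed
    have t5: "(real (n div super_size n) + 1) * (3 * real (field_width n) * real (block_count n)) \<le> 30 * n / lo + 30 * hi * (x + 1) ^ 2"
    proof -
      have eq: "3 * real (field_width n) * real (block_count n) = 30 * e * L\<^sup>2"
        by (simp add: field_width_def block_count_def e_def L_def power2_eq_square)
      have "(real (n div super_size n) + 1) * (30 * e * L\<^sup>2) \<le> (n / (e\<^sup>2 * L\<^sup>2) + 1) * (30 * e * L\<^sup>2)"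
        using ns L2 e1 by (intro mult_right_mono) auto
      also have "\<dots> = 30 * n / e + 30 * e * L\<^sup>2" using L2 e1 by (simp add: field_simps power2_eq_square)
      also have "30 * n / e \<le> 30 * n / lo" using e lo by (intro divide_left_mono) auto
      also have "30 * e * L\<^sup>2 \<le> 30 * hi * (x + 1) ^ 2"
        using e e1 L L2 by (intro mult_mono mult_left_mono power_mono) auto
      finally show ?thesis unfolding eq by simp
    qed
    have t6: "real (n div block_size n) \<le> n / lo ^ 2"
    proof -
      have "real (n div block_size n) \<le> n / e\<^sup>2"
        using divle[of n "block_size n"] by (simp add: block_size_def e_def power2_eq_square)
      also have "\<dots> \<le> n / lo ^ 2" using e lo by (intro divide_left_mono power_mono) auto
      finally show ?thesis .
    qed
    have "real (overhead 0 n) = 3 * e + 1 + 3 * (3 * L) + (real (n div super_size n) + 1) * (4 * (3 * L)) +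
      2 ^ field_width n * 2 ^ window_width n * real (block_size n) * real (field_width n) +
      (real (6 * n * bit_length n div extent_bound n) + 1) * (super_size n * (3 * L)) +
      (real (n div super_size n) + 1) * (3 * real (field_width n) * real (block_count n)) + real (n div block_size n)"
      by (simp add: overhead_def index_size_def data_excess_def ptr_width_def e_def L_def distrib_right)
    also have "\<dots> \<le> 13 * (x + 1) + (12 * n / x + 12 * (x + 1)) + 2 powr (22 * hi ^ 3) +
     (18 * n * hi ^ 2 / x + 3 * hi ^ 2 * (x + 1) ^ 3) + (30 * n / lo + 30 * hi * (x + 1) ^ 2) +
     n / lo ^ 2"
      using t1 t2 t3 t4 t5 t6 by linarith
    finally show ?case unfolding Let_def x_def lo_def hi_def by simp
  qed
qed

lemma overhead_smallo: "(\<lambda>n. real (overhead K n)) \<in> o(\<lambda>n. real n)"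
proof (rule landau_o.big_small_trans[OF bigoI overhead_0_smallo])
  show "eventually (\<lambda>n. norm (real (overhead K n)) \<le> (1 + real K) * norm (real (overhead 0 n))) sequentially"
    using eventually_ge_at_top[of 1]
  proof eventually_elim
    case (elim n)
    then have "real (overhead K n) \<le> real ((1 + K) * overhead 0 n)"
      using overhead_le[of n K] by (simp only: of_nat_le_iff)
    then show ?case by (simp add: algebra_simps)
  qed
qed

lemma slack_smallo: "(\<lambda>n. 3 * real n / real (bit_length n)) \<in> o(\<lambda>n. real n)"
proof (rule landau_o.big_small_trans[OF bigoI])
  show "eventually (\<lambda>n. norm (3 * real n / real (bit_length n)) \<le> 1 * norm (3 * real n / log 2 (real n))) sequentially"
    using eventually_ge_at_top[of 2]
  proof eventually_elim
    case (elim n)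
    then have "0 < log 2 (real n)" by simp
    then show ?case
      using bit_length_real(1)[of n] bit_length_pos[of n] elim
      by (auto intro!: divide_left_mono mult_pos_pos)
  qed
  show "(\<lambda>n::nat. 3 * real n / log 2 (real n)) \<in> o(\<lambda>n. real n)" by real_asymp
qed

text \<open>As \<open>overhead 0 n \<le> c * n\<close>, the first bound asks for
  \<open>(1 + K) * (c + 6) \<le> 2 ^ K\<close>. For the second,
  \<open>8 * overhead K n \<le> n\<close> for large \<open>n\<close>, and \<open>W\<close> dominates
  the finitely many exceptions.\<close>

lemma overhead_bounds:
  obtains K W where "4 \<le> K" "8 \<le> W"
    "\<And>n. 1 \<le> n \<Longrightarrow> overhead K n + 6 * n * bit_length n \<le> 2 ^ ptr_width K n"
    "\<And>w n. W \<le> w \<Longrightarrow> n < 2 ^ w \<Longrightarrow> 8 * overhead K n \<le> 2 ^ w"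
proof -
  have "eventually (\<lambda>n. norm (real (overhead 0 n)) \<le> 1 * norm (real n)) sequentially"
    using overhead_0_smallo by (rule landau_o.smallD) simp
  then obtain N where N: "overhead 0 n \<le> n" if "N \<le> n" for n
    by (auto simp: eventually_sequentially)
  define c where "c = Max (insert 1 (overhead 0 ` {..<N}))"
  have c: "overhead 0 n \<le> c * n" if "1 \<le> n" for n
  proof (cases "n < N")
    case True
    then have "overhead 0 n \<le> c" by (auto simp: c_def)
    also have "\<dots> \<le> c * n" using that by simp
    finally show ?thesis .
  next
    case False
    have "1 \<le> c" by (auto simp: c_def)
    then show ?thesis using N[of n] False by (metis le_trans linorder_not_less mult.left_neutral mult_le_mono1)
  qed
  have "eventually (\<lambda>k::nat. (1 + real k) * (real c + 6) \<le> 2 powr real k) sequentially"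
    by real_asymp
  moreover have "eventually (\<lambda>k::nat. 4 \<le> k) sequentially" by (rule eventually_ge_at_top)
  ultimately have "eventually (\<lambda>k::nat. 4 \<le> k \<and> (1 + real k) * (real c + 6) \<le> 2 powr real k) sequentially"
    by eventually_elim simp
  then obtain K :: nat where K: "4 \<le> K" "(1 + real K) * (real c + 6) \<le> 2 powr real K"
    by (auto simp: eventually_sequentially)
  have "real ((1 + K) * (c + 6)) \<le> real (2 ^ K)"
    using K(2) by (simp add: powr_realpow algebra_simps)
  then have K2: "(1 + K) * (c + 6) \<le> 2 ^ K" by (simp only: of_nat_le_iff)
  have 1: "overhead K n + 6 * n * bit_length n \<le> 2 ^ ptr_width K n" if n: "1 \<le> n" for n
  proof -
    have L1: "1 \<le> bit_length n" using bit_length_pos[OF n] .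
    have "overhead K n + 6 * n * bit_length n \<le> (1 + K) * (c * n) + 6 * n * bit_length n"
      using overhead_le[OF n, of K] c[OF n] by (meson add_le_mono1 le_trans mult_le_mono2)
    also have "\<dots> \<le> (1 + K) * (c * (n * bit_length n)) + (1 + K) * (6 * (n * bit_length n))"
      using L1 by (intro add_mono mult_le_mono2) auto
    also have "\<dots> = ((1 + K) * (c + 6)) * (n * bit_length n)" by (simp add: algebra_simps)
    also have "\<dots> \<le> 2 ^ K * (2 ^ bit_length n * 2 ^ bit_length n)"
      using K2 less_two_power_bit_length[of n] by (intro mult_le_mono) (auto intro: less_imp_le)
    also have "\<dots> = 2 ^ (K + 2 * bit_length n)" by (simp add: power_add mult_2)
    also have "\<dots> \<le> 2 ^ ptr_width K n" by (intro power_increasing) (auto simp: ptr_width_def)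
    finally show ?thesis .
  qed
  have "eventually (\<lambda>n. norm (real (overhead K n)) \<le> (1 / 8) * norm (real n)) sequentially"
    using overhead_smallo[of K] by (rule landau_o.smallD) simp
  then obtain M where M': "\<And>n. M \<le> n \<Longrightarrow> real (overhead K n) \<le> real n / 8"
    by (auto simp: eventually_sequentially)
  have M: "8 * overhead K n \<le> n" if "M \<le> n" for n
    using M'[OF that] by linarith
  define W where "W = Max (insert 8 ((\<lambda>n. 8 * overhead K n) ` {..<M}))"
  have 2: "8 * overhead K n \<le> 2 ^ w" if "W \<le> w" "n < 2 ^ w" for w n
  proof (cases "n < M")
    case True
    then have "8 * overhead K n \<le> W" by (auto simp: W_def)
    also have "\<dots> \<le> 2 ^ w" using that less_exp[of w] by linarith
    finally show ?thesis .
  next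
    case False
    then show ?thesis using M[of n] that by simp
  qed
  have "8 \<le> W" by (simp add: W_def)
  from that[OF K(1) this 1 2] show ?thesis .
qed

section \<open>Splitting the elements\<close>

lemma radix_less:
  fixes q :: nat
  assumes "\<And>k. k < n \<Longrightarrow> l k < q"
  shows "(\<Sum>k<n. l k * q ^ k) < q ^ n"
  using assms
proof (induction n)
  case (Suc n)
  then have "(\<Sum>k<n. l k * q ^ k) + l n * q ^ n < q ^ n + l n * q ^ n" by simp
  also have "\<dots> = (l n + 1) * q ^ n" by simp
  also have "\<dots> \<le> q * q ^ n" using Suc.prems[of n] by (intro mult_le_mono1) simp
  finally show ?case by simp
qed simp

lemma radix_digit:
  fixes q :: nat
  assumes "\<And>k. k < n \<Longrightarrow> l k < q" "j < n"
  shows "(\<Sum>k<n. l k * q ^ k) div q ^ j mod q = l j"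
proof -
  have q: "0 < q" using assms(1)[of j] assms(2) by simp
  obtain r where r: "n = Suc j + r" using assms(2) less_iff_Suc_add by fastforce
  have "(\<Sum>k<n. l k * q ^ k) = (\<Sum>k<Suc j. l k * q ^ k) + (\<Sum>k<r. l (Suc j + k) * q ^ (Suc j + k))"
    unfolding r by (induction r) (simp_all add: add.assoc)
  also have "(\<Sum>k<r. l (Suc j + k) * q ^ (Suc j + k)) = q ^ j * (q * (\<Sum>k<r. l (Suc j + k) * q ^ k))"
    by (simp add: sum_distrib_left power_add algebra_simps)
  finally have eq: "(\<Sum>k<n. l k * q ^ k) =
      (\<Sum>k<j. l k * q ^ k) + q ^ j * (l j + q * (\<Sum>k<r. l (Suc j + k) * q ^ k))"
    by (simp add: algebra_simps)
  have "(\<Sum>k<j. l k * q ^ k) < q ^ j" using assms by (intro radix_less) auto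
  then have "(\<Sum>k<n. l k * q ^ k) div q ^ j = l j + q * (\<Sum>k<r. l (Suc j + k) * q ^ k)"
    unfolding eq using q by simp
  then show ?thesis using assms by simp
qed

text \<open>Modulo \<open>2 ^ v - q\<close> the power \<open>2 ^ v\<close> is \<open>q\<close>; this makes a power with variable exponent
  available in constant time.\<close>

lemma power_via_mod:
  fixes q :: nat
  assumes "q ^ k + q < 2 ^ v"
  shows "2 ^ (v * k) mod (2 ^ v - q) = q ^ k"
proof -
  have "(2 ^ v :: nat) mod (2 ^ v - q) = q mod (2 ^ v - q)"
  proof -
    have "(2 ^ v :: nat) = q + (2 ^ v - q)" using assms by simp
    then show ?thesis by (metis mod_add_self2)
  qed
  then have "(2 ^ v) ^ k mod (2 ^ v - q) = q ^ k mod (2 ^ v - q)"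
    by (metis power_mod)
  then show ?thesis using assms by (simp add: power_mult)
qed

locale elements =
  fixes w n m K :: nat and x :: "nat \<Rightarrow> nat"
  assumes n_pos: "1 \<le> n" and n_le_m: "n \<le> m" and m_less: "m < 2 ^ w" and w_large: "256 \<le> w"
    and x_mono: "\<And>j k. j < k \<Longrightarrow> k < n \<Longrightarrow> x j < x k" and x_less: "\<And>k. k < n \<Longrightarrow> x k < m"
    and K_ge: "4 \<le> K"
    and overhead_ptr: "overhead K n + 6 * n * bit_length n \<le> 2 ^ ptr_width K n"
    and overhead_word: "8 * overhead K n \<le> 2 ^ w"
begin

abbreviation L :: nat where "L \<equiv> bit_length n"

text \<open>An element \<open>x\<close> is split as \<open>x = (Y * q + l) * 2 ^ \<kappa> + r\<close>. Ideally \<open>q = 1\<close>, but then \<open>\<kappa>\<close> is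
  about \<open>lg m\<close>: it cannot be stored (that takes \<open>lg (lg m)\<close> bits, which no function of \<open>n\<close> bounds),
  and it is unclear how to compute it in constant time. Therefore \<open>\<kappa>\<close> is a multiple \<open>p * h\<close>, where \<open>h\<close> is computed
  from \<open>w\<close> and \<open>n\<close> and only \<open>p = O(n ^ 3)\<close> is stored. When \<open>h > 1\<close>, all the \<open>l\<close> together fit into a
  single word as the digits of a number in radix \<open>q\<close>.\<close>

definition dense :: bool where "dense \<longleftrightarrow> m div (4 * L) < n"
definition D :: nat where "D = (if dense then m else 2 * n * L)"
definition h :: nat where "h = w div 16 div n div n div n + 1"
text \<open>The last multiple of \<open>h\<close> by which \<open>m\<close> can be shifted right
  without falling below \<open>D\<close>.\<close>

definition p :: nat where "p = (LEAST p. m div 2 ^ (Suc p * h) < D)"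
definition \<kappa> :: nat where "\<kappa> = p * h"
text \<open>The factor by which the shifted \<open>m\<close> still exceeds \<open>D\<close>; the
  choice of \<open>p\<close> keeps it below \<open>2 ^ h\<close>.\<close>

definition q :: nat where "q = m div 2 ^ \<kappa> div D"
definition Q :: nat where "Q = q * 2 ^ \<kappa>"
definition z :: "nat \<Rightarrow> nat" where "z k = x k div Q + (if dense then 0 else k)"
definition U :: nat where "U = (if dense then m else (m - 1) div Q + n)"

section \<open>Bounds on the splitting parameters\<close>

lemma L_pos: "1 \<le> L" using n_pos by (rule bit_length_pos)

lemma dense_iff: "dense \<longleftrightarrow> m < 4 * n * L"
  using L_pos unfolding dense_def by (simp add: div_less_iff_less_mult mult.commute mult.left_commute)

lemma D_pos: "1 \<le> D" using L_pos n_pos n_le_m by (simp add: D_def)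

lemma D_le: "D \<le> m" using dense_iff by (auto simp: D_def)

lemma h_pos: "1 \<le> h" by (simp add: h_def)

lemma p_props: "m div 2 ^ (\<kappa> + h) < D" "D \<le> m div 2 ^ \<kappa>"
proof -
  have "m < 2 ^ (Suc m * h)"
  proof (rule less_le_trans[OF less_exp])
    have "m * 1 \<le> Suc m * h" using h_pos by (intro mult_le_mono) auto
    then show "2 ^ m \<le> (2::nat) ^ (Suc m * h)" by (intro power_increasing) auto
  qed
  then have "m div 2 ^ (Suc m * h) < D" using D_pos by simp
  from LeastI[of "\<lambda>p. m div 2 ^ (Suc p * h) < D", OF this]
  show "m div 2 ^ (\<kappa> + h) < D" unfolding p_def[symmetric] \<kappa>_def by (simp add: add.commute)
  show "D \<le> m div 2 ^ \<kappa>"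
  proof (cases p)
    case 0
    then show ?thesis using D_le by (simp add: \<kappa>_def)
  next
    case (Suc p')
    then have "p' < (LEAST p. m div 2 ^ (Suc p * h) < D)" by (simp add: p_def)
    from not_less_Least[OF this] show ?thesis using Suc by (simp add: \<kappa>_def)
  qed
qed

lemma p_dense: "dense \<Longrightarrow> p = 0"
proof -
  assume "dense"
  moreover have "1 < (2::nat) ^ h" using h_pos by (intro one_less_power) auto
  ultimately have "m div 2 ^ (Suc 0 * h) < D"
    using n_pos n_le_m by (simp add: D_def int_one_le_iff_zero_less)
  then show ?thesis unfolding p_def by (intro Least_equality) auto
qed

lemma q_pos: "1 \<le> q"
proof -
  have "D div D \<le> m div 2 ^ \<kappa> div D" by (intro div_le_mono p_props(2))
  then show ?thesis using D_pos by (simp add: q_def)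
qed

lemma q_less: "q < 2 ^ h"
proof -
  have "m div 2 ^ \<kappa> div 2 ^ h < D"
    using p_props(1) by (simp add: power_add div_mult2_eq)
  then have "m div 2 ^ \<kappa> < D * 2 ^ h" by (simp add: div_less_iff_less_mult)
  then show ?thesis unfolding q_def using D_pos by (simp add: div_less_iff_less_mult mult.commute)
qed

lemma Q_dense: "dense \<Longrightarrow> Q = 1"
  using p_dense n_pos n_le_m by (auto simp: q_def Q_def \<kappa>_def D_def)

lemma q_eq_1: "h = 1 \<Longrightarrow> q = 1"
  using q_pos q_less by simp

lemma Q_pos: "1 \<le> Q" using q_pos by (simp add: Q_def)

lemma D_Q_le: "D * Q \<le> m"
proof -
  have "D * q \<le> m div 2 ^ \<kappa>" unfolding q_def by (simp add: mult.commute)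
  then have "D * q * 2 ^ \<kappa> \<le> m" using D_pos
    by (simp add: less_eq_div_iff_mult_less_eq)
  then show ?thesis by (simp add: Q_def)
qed

text \<open>Since \<open>q + 1 \<le> 2 * q\<close>, rounding \<open>q\<close> down loses at most a
  factor of 2. Together with \<open>D_Q_le\<close>, \<open>Q\<close> approximates
  \<open>m / D\<close> up to that factor.\<close>

lemma m_less_D_Q: "m < 2 * D * Q"
proof -
  have "m div 2 ^ \<kappa> < (q + 1) * D"
    unfolding q_def using D_pos dividend_less_div_times[of D "m div 2 ^ \<kappa>"] by simp
  also have "\<dots> \<le> 2 * q * D" using q_pos by (intro mult_le_mono1) simp
  finally have "m < 2 * q * D * 2 ^ \<kappa>" by (simp add: div_less_iff_less_mult)
  then show ?thesis by (simp add: Q_def algebra_simps)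
qed

text \<open>The dense threshold \<open>4 * n * L\<close> is twice \<open>D\<close>, so that
  \<open>m < 2 * D * Q\<close> excludes \<open>Q = 1\<close>. With \<open>Q \<ge> 2\<close> the
  quotients plus indices stay below \<open>m\<close>.\<close>

lemma Q_sparse:
  assumes "\<not> dense"
  shows "2 \<le> Q" "2 * n * L * Q \<le> m" "4 * n * L \<le> m"
proof -
  have D: "D = 2 * n * L" using assms by (simp add: D_def)
  show m: "4 * n * L \<le> m" using assms dense_iff by simp
  show "2 * n * L * Q \<le> m" using D_Q_le D by simp
  have "Q \<noteq> 1" using m m_less_D_Q D by auto
  then show "2 \<le> Q" using Q_pos by simp
qed

lemma U_le_m: "U \<le> m"
proof (cases dense)
  case False
  note s = Q_sparse[OF False]
  have "4 * n \<le> 4 * n * L" using L_pos by simp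
  then have "4 * n \<le> m" using s(3) by linarith
  moreover have "(m - 1) div Q \<le> m div 2" using s(1) by (intro div_le_mono2 [THEN order_trans, OF _ _ div_le_mono]) auto
  ultimately show ?thesis using False by (simp add: U_def)
qed (simp add: U_def)

lemma U_less: "U < 6 * n * L"
proof (cases dense)
  case True
  then show ?thesis using dense_iff by (simp add: U_def)
next
  case False
  have "(m - 1) div Q \<le> m div Q" by (intro div_le_mono) simp
  also have "m div Q < 2 * D" using m_less_D_Q Q_pos by (simp add: div_less_iff_less_mult)
  finally have "(m - 1) div Q < 4 * n * L" using False by (simp add: D_def)
  moreover have "n \<le> n * L" using L_pos by simp
  moreover have "U = (m - 1) div Q + n" using False by (simp add: U_def)
  ultimately show ?thesis by linarith
qed

lemma z_mono: "j < k \<Longrightarrow> k < n \<Longrightarrow> z j < z k"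
  using x_mono[of j k] Q_dense by (auto simp: z_def intro: add_le_less_mono div_le_mono less_imp_le)

lemma z_less: "k < n \<Longrightarrow> z k < U"
proof -
  assume k: "k < n"
  show ?thesis
  proof (cases dense)
    case True
    then show ?thesis using x_less[OF k] Q_dense by (simp add: z_def U_def)
  next
    case False
    have "x k div Q \<le> (m - 1) div Q" using x_less[OF k] by (intro div_le_mono) simp
    then show ?thesis using False k by (simp add: z_def U_def)
  qed
qed

lemma \<kappa>_bounds: "\<kappa> < w" "n * \<kappa> \<le> 2 ^ w div 2"
proof -
  have D\<kappa>: "D * 2 ^ \<kappa> \<le> m" using p_props(2) by (simp add: less_eq_div_iff_mult_less_eq)
  have "2 ^ \<kappa> \<le> D * 2 ^ \<kappa>" using D_pos by simp
  then have "2 ^ \<kappa> \<le> m" using D\<kappa> by linarith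
  then have "(2::nat) ^ \<kappa> < 2 ^ w" using m_less by linarith
  then show "\<kappa> < w" by simp
  show "n * \<kappa> \<le> 2 ^ w div 2"
  proof (cases dense)
    case True
    then show ?thesis using p_dense by (simp add: \<kappa>_def)
  next
    case False
    then have "2 * (n * \<kappa>) \<le> D * \<kappa>" using L_pos by (simp add: D_def)
    also have "\<dots> \<le> D * 2 ^ \<kappa>" by (intro mult_le_mono2) (simp add: less_imp_le)
    finally have "2 * (n * \<kappa>) \<le> m" using D\<kappa> by linarith
    then show ?thesis using m_less by linarith
  qed
qed

text \<open>\<open>h\<close> exceeds \<open>w / (16 * n ^ 3)\<close> while \<open>p * h < w\<close>,
  hence \<open>p < 16 * n ^ 3\<close>. The factor 16 is the reason for
  \<open>4 \<le> K\<close>.\<close>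

lemma p_less: "p < 2 ^ w" "p < 2 ^ ptr_width K n"
proof -
  have pk: "p \<le> \<kappa>" using h_pos by (simp add: \<kappa>_def)
  then show "p < 2 ^ w" using \<kappa>_bounds(1) less_exp[of w] by linarith
  have n3: "0 < 16 * (n * n * n)" using n_pos by simp
  have heq: "h = w div (16 * (n * n * n)) + 1" by (simp add: h_def div_mult2_eq)
  have "w < h * (16 * (n * n * n))" unfolding heq using n3
    by (metis Suc_eq_plus1 add.commute dividend_less_div_times mult_Suc)
  then have "p * h < 16 * (n * n * n) * h" 
    using \<kappa>_bounds(1) unfolding \<kappa>_def mult.commute[of h] by linarith
  then have "p < 16 * (n * n * n)" by (rule mult_less_cancel2[THEN iffD1, THEN conjunct2])
  also have "\<dots> \<le> 2 ^ 4 * (2 ^ L * 2 ^ L * 2 ^ L)"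
    using less_two_power_bit_length[of n] by (intro mult_le_mono) auto
  also have "\<dots> = 2 ^ (4 + 3 * L)" by (simp add: power_add eval_nat_numeral)
  also have "\<dots> \<le> 2 ^ ptr_width K n" using K_ge by (intro power_increasing) (auto simp: ptr_width_def)
  finally show "p < 2 ^ ptr_width K n" .
qed

text \<open>\<open>q \<noteq> 1\<close> forces \<open>h > 1\<close>, thus
  \<open>16 * n ^ 3 \<le> w\<close>, which gives \<open>h * n * n \<le> w / 8\<close> and
  \<open>n \<le> w / 16\<close>. So the shift by \<open>(h * n + 1) * k\<close> in the computation
  of \<open>q ^ k\<close> stays inside a word.\<close>

lemma h_bound:
  assumes "q \<noteq> 1"
  shows "(h * n + 1) * n < w"
proof -
  have n3: "0 < 16 * (n * n * n)" using n_pos by simp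
  have heq: "h = w div (16 * (n * n * n)) + 1" by (simp add: h_def div_mult2_eq)
  have "h \<noteq> 1" using q_eq_1 assms by blast
  then have w: "16 * (n * n * n) \<le> w" using heq by (metis add_0 div_less not_le)
  have "w div (16 * (n * n * n)) * (16 * (n * n * n)) \<le> w" by simp
  then have "h * (16 * (n * n * n)) \<le> 2 * w" unfolding heq distrib_right using w by linarith
  moreover have "h * (n * n) \<le> h * (n * n * n)" "n \<le> n * n * n" using n_pos by auto
  ultimately have "16 * (h * (n * n)) \<le> 2 * w" "16 * n \<le> w" using w by linarith+
  moreover have "(h * n + 1) * n = h * (n * n) + n" by (simp add: algebra_simps)
  ultimately show ?thesis using w_large by linarith
qed

lemma q_power_bound: "k < n \<Longrightarrow> q ^ k + q < 2 ^ (h * n + 1)"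
proof -
  assume k: "k < n"
  have "q ^ k \<le> (2 ^ h) ^ k" using q_less by (intro power_mono) auto
  also have "\<dots> = 2 ^ (h * k)" by (simp add: power_mult)
  also have "\<dots> \<le> 2 ^ (h * n)" using k by (intro power_increasing) auto
  finally have "q ^ k \<le> 2 ^ (h * n)" .
  moreover have "2 ^ h \<le> (2::nat) ^ (h * n)" using n_pos by (intro power_increasing) auto
  ultimately show ?thesis using q_less unfolding power_add power_one_right by linarith
qed

text \<open>Both binomial coefficients are products of \<open>n\<close> quotients, compared factor
  by factor: the added indices enlarge \<open>U * Q\<close> by at most \<open>n * Q\<close>, which
  is a fraction \<open>y\<close> of \<open>m\<close>.\<close>

lemma choose_U_le:
  "real (U choose n) * real Q ^ n \<le> real (m choose n) * 2 powr (3 * real n / real L)"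
proof (cases dense)
  case True
  then have "real (U choose n) * real Q ^ n = real (m choose n) * 1"
    using Q_dense by (simp add: U_def)
  also have "\<dots> \<le> real (m choose n) * 2 powr (3 * real n / real L)"
    by (intro mult_left_mono) (auto simp: ge_one_powr_ge_zero)
  finally show ?thesis .
next
  case False
  note s = Q_sparse[OF False]
  define y where "y = 1 / (2 * real L)"
  have L1: "1 \<le> real L" using L_pos by linarith
  have y: "0 < y" "y \<le> 1" using L1 by (auto simp: y_def field_simps)
  have nQ: "real n * real Q \<le> y * real m"
  proof -
    have "real (2 * n * L * Q) \<le> real m" using s(2) by (simp only: of_nat_le_iff)
    then show ?thesis using L1 by (simp add: y_def field_simps)
  qed
  have n: "real n \<le> y / 2 * real m"
  proof -
    have "real (4 * n * L) \<le> real m" using s(3) by (simp only: of_nat_le_iff)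
    then show ?thesis using L1 by (simp add: y_def field_simps)
  qed
  have ratio: "real (U - k) / real (n - k) * real Q \<le> real (m - k) / real (n - k) * (1 + 3 * y)"
    if k: "k < n" for k
  proof -
    have "real ((m - 1) div Q) \<le> real (m - 1) / real Q" by (rule of_nat_div_le_of_nat)
    also have "\<dots> \<le> real m / real Q" by (intro divide_right_mono) auto
    finally have "real ((m - 1) div Q) * real Q \<le> real m" using Q_pos by (simp add: field_simps)
    moreover have "real (U - k) \<le> real ((m - 1) div Q) + real n" using False by (simp add: U_def)
    ultimately have "real (U - k) * real Q \<le> real m + real n * real Q"
      using mult_right_mono[of "real (U - k)" "real ((m - 1) div Q) + real n" "real Q"]
      by (simp add: algebra_simps)
    also have "\<dots> \<le> real m * (1 + y)" using nQ by (simp add: algebra_simps)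
    \<comment> \<open>The factor \<open>1 - y / 2\<close> pays for replacing \<open>m\<close> by
      \<open>m - k\<close>; the price is \<open>3 * y\<close> in place of \<open>y\<close>.\<close>
    also have "\<dots> \<le> real m * ((1 - y / 2) * (1 + 3 * y))"
    proof (intro mult_left_mono)
      have "y * y \<le> y" using y by (simp add: mult_left_le_one_le)
      then show "1 + y \<le> (1 - y / 2) * (1 + 3 * y)" by (simp add: algebra_simps)
    qed simp
    also have "\<dots> = (real m - y / 2 * real m) * (1 + 3 * y)" by (simp add: field_simps)
    also have "\<dots> \<le> real (m - k) * (1 + 3 * y)"
      using n k n_le_m y by (intro mult_right_mono) (auto simp: of_nat_diff)
    finally have "real (U - k) * real Q / real (n - k) \<le> real (m - k) * (1 + 3 * y) / real (n - k)"
      by (rule divide_right_mono) simp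
    then show ?thesis by simp
  qed
  have nU: "n \<le> U" using False by (simp add: U_def)
  have "real (U choose n) * real Q ^ n = (\<Prod>k=0..<n. real (U - k) / real (n - k) * real Q)"
    unfolding binomial_altdef_of_nat[OF nU] prod.distrib by simp
  also have "\<dots> \<le> (\<Prod>k=0..<n. real (m - k) / real (n - k) * (1 + 3 * y))"
    using ratio by (intro prod_mono) auto
  also have "\<dots> = real (m choose n) * (1 + 3 * y) ^ n"
    unfolding binomial_altdef_of_nat[OF n_le_m] prod.distrib by simp
  also have "\<dots> \<le> real (m choose n) * 2 powr (3 * real n / real L)"
  proof (intro mult_left_mono)
    have "(1 + 3 * y) ^ n \<le> exp (3 * y) ^ n" using y by (intro power_mono) auto
    also have "\<dots> = exp (3 * y * real n)" by (simp add: exp_of_nat_mult[symmetric] mult.commute)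
    also have "\<dots> \<le> exp (3 * real n / real L * ln 2)"
    proof -
      have "3 * y * real n = 3 * real n / real L * (1 / 2)" by (simp add: y_def)
      also have "\<dots> \<le> 3 * real n / real L * ln 2"
        using exp_half_le2 by (intro mult_left_mono ln_ge_iff[THEN iffD2]) simp_all
      finally show ?thesis by simp
    qed
    also have "\<dots> = 2 powr (3 * real n / real L)" by (simp add: powr_def)
    finally show "(1 + 3 * y) ^ n \<le> 2 powr (3 * real n / real L)" .
  qed simp
  finally show ?thesis .
qed

end

section \<open>The memory layout\<close>

lemma bits_val_unary: "bits_val (replicate e False @ True # r) = 2 ^ e + 2 ^ Suc e * bits_val r"
  by (induction e) auto

text \<open>\<open>X\<close> and \<open>X - 1\<close> agree above the lowest set bit of
  \<open>X\<close>. This reads a unary prefix without a loop.\<close>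

lemma xor_pred:
  fixes y :: nat
  assumes "X = 2 ^ e + 2 ^ Suc e * y"
  shows "Bit_Operations.xor X (X - 1) = 2 ^ Suc e - 1"
proof -
  have 1: "X = Bit_Operations.or (push_bit (Suc e) y) (2 ^ e)"
  proof -
    have "X = push_bit (Suc e) y + 2 ^ e" by (simp only: assms push_bit_eq_mult ac_simps)
    also have "\<dots> = Bit_Operations.or (push_bit (Suc e) y) (2 ^ e)"
      by (rule disjunctive_add) (auto simp: bit_push_bit_iff bit_exp_iff simp del: push_bit_Suc)
    finally show ?thesis .
  qed
  have 2: "X - 1 = Bit_Operations.or (push_bit (Suc e) y) (mask e)"
  proof -
    have "X - 1 = push_bit (Suc e) y + mask e"
      by (simp add: assms push_bit_eq_mult mask_eq_exp_minus_1 mult.commute add.commute)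
    also have "\<dots> = Bit_Operations.or (push_bit (Suc e) y) (mask e)"
      by (rule disjunctive_add) (auto simp: bit_push_bit_iff bit_mask_iff simp del: push_bit_Suc)
    finally show ?thesis .
  qed
  have "Bit_Operations.xor X (X - 1) = mask (Suc e)"
    unfolding 2 unfolding 1
    by (rule bit_eqI) (auto simp: bit_xor_iff bit_or_iff bit_push_bit_iff bit_mask_iff bit_exp_iff
        simp del: push_bit_Suc)
  then show ?thesis by (simp add: mask_eq_exp_minus_1)
qed

lemma drop_bit_append: "drop_bit (length xs) (bits_val (xs @ ys)) = bits_val ys"
  by (rule bit_eqI) (auto simp: bit_drop_bit_eq bit_horner_sum_bit_iff nth_append)

context elements
begin

abbreviation E :: nat where "E \<equiv> level n"
abbreviation \<gamma> :: nat where "\<gamma> \<equiv> field_width n"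
abbreviation \<delta> :: nat where "\<delta> \<equiv> window_width n"
abbreviation b0 :: nat where "b0 \<equiv> block_size n"
abbreviation B :: nat where "B \<equiv> block_count n"
abbreviation b1 :: nat where "b1 \<equiv> super_size n"

text \<open>If \<open>n\<close> is close to \<open>m\<close>, the width \<open>3 * L + K\<close> may
  exceed \<open>w\<close>, but a field must fit into a word. The other bound keeps the cost a
  function of \<open>n\<close>.\<close>

definition g :: nat where "g = min w (ptr_width K n)"

lemma E_pos: "1 \<le> E" using n_pos by (rule level_pos)

lemma U_le_g: "U \<le> 2 ^ g"
  using U_le_m m_less U_less overhead_ptr by (auto simp: g_def min_def)

sublocale bs: block_seq z n U b0 B "extent_bound n" \<gamma> \<delta> g
proof
  show "0 < b0" using E_pos by (simp add: block_size_def)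
  show "0 < B" using L_pos by (simp add: block_count_def)
  show "0 < extent_bound n" using L_pos by (simp add: extent_bound_def)
  show "3 * \<gamma> * B + B * \<delta> < 2 ^ \<gamma>" using field_width_large[OF n_pos] .
qed (fact z_mono z_less extent_bound_pow extent_bound_less[OF n_pos])+

lemma b1_eq: "bs.b1 = b1" by (simp add: bs.b1_def super_size_def)

text \<open>Pointers are split into a word address and a bit offset, since a bit position may exceed
  \<open>2 ^ w\<close>. The number \<open>R\<close> comes last because its length is not known to the program: the memory
  behind it reads as zero.\<close>

definition J :: nat where "J = n div b1 + 1"
definition dir_base :: nat where "dir_base = 3 * E + 1 + 3 * g"
definition tab_base :: nat where "tab_base = dir_base + J * (4 * g)"
definition tab_len :: nat where "tab_len = 2 ^ \<gamma> * 2 ^ \<delta> * b0"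
definition z_base :: nat where "z_base = tab_base + tab_len * \<gamma>"
definition sb_pos :: "nat \<Rightarrow> nat" where
  "sb_pos j = z_base + (\<Sum>j'<j. length (bs.superblock j'))"
definition low_pos :: nat where "low_pos = sb_pos J"

text \<open>The unary prefix yields only \<open>2 ^ E\<close>, from which no RAM instruction
  extracts the exponent; hence \<open>E\<close> is repeated in binary, now with a known
  modulus.\<close>

definition header :: "bool list" where
  "header = replicate E False @ [True] @ nat_bits E E @ nat_bits E L @ nat_bits g p @
     nat_bits g (low_pos div w) @ nat_bits g (low_pos mod w)"
definition dir_entry :: "nat \<Rightarrow> bool list" where
  "dir_entry j = nat_bits g (sb_pos j div w) @ nat_bits g (sb_pos j mod w) @
     nat_bits g (z (j * b1)) @ nat_bits g (of_bool (bs.escaped j))"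
definition directory :: "bool list" where "directory = concat (map dir_entry [0..<J])"
definition table :: "bool list" where
  "table = concat (map (\<lambda>k. nat_bits \<gamma> (bs.table_entry k)) [0..<tab_len])"
definition zdata :: "bool list" where "zdata = concat (map bs.superblock [0..<J])"
definition lows :: "bool list" where "lows = concat (map (\<lambda>k. nat_bits \<kappa> (x k)) [0..<n])"
definition residue :: "nat \<Rightarrow> nat" where "residue k = x k div 2 ^ \<kappa> mod q"
definition R :: nat where "R = (\<Sum>k<n. residue k * q ^ k)"
text \<open>As \<open>q ^ n choose 1 = q ^ n\<close>, this is the number of bits for a number below
  \<open>q ^ n\<close>.\<close>

definition r_len :: nat where "r_len = code_len (q ^ n) 1"
definition layout :: "bool list" where
  "layout = header @ directory @ table @ zdata @ lows @ nat_bits r_len R"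

section \<open>Positions of the fields in the layout\<close>

lemma length_header: "length header = dir_base" by (simp add: header_def dir_base_def)
lemma length_directory: "length directory = J * (4 * g)"
  by (simp add: directory_def dir_entry_def length_concat_map)
lemma length_table: "length table = tab_len * \<gamma>"
  by (simp add: table_def length_concat_map)
lemma length_zdata: "z_base + length zdata = low_pos"
  by (simp add: zdata_def length_concat_map low_pos_def sb_pos_def)
lemma length_lows: "length lows = n * \<kappa>"
  by (simp add: lows_def length_concat_map)

lemma occurs_parts:
  "occurs_at layout 0 header" "occurs_at layout dir_base directory"
  "occurs_at layout tab_base table" "occurs_at layout z_base zdata"
  "occurs_at layout low_pos lows" "occurs_at layout (low_pos + n * \<kappa>) (nat_bits r_len R)"
proof -
  have r0: "occurs_at layout 0 (header @ directory @ table @ zdata @ lows @ nat_bits r_len R)"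
    using occurs_at_self[of layout] by (simp only: layout_def)
  note r1 = occurs_at_appendD(2)[OF r0, unfolded length_header add_0]
  note r2 = occurs_at_appendD(2)[OF r1, unfolded length_directory, folded tab_base_def]
  note r3 = occurs_at_appendD(2)[OF r2, unfolded length_table, folded z_base_def]
  note r4 = occurs_at_appendD(2)[OF r3, unfolded length_zdata]
  note r5 = occurs_at_appendD(2)[OF r4, unfolded length_lows]
  show "occurs_at layout 0 header" "occurs_at layout dir_base directory"
    "occurs_at layout tab_base table" "occurs_at layout z_base zdata"
    "occurs_at layout low_pos lows" "occurs_at layout (low_pos + n * \<kappa>) (nat_bits r_len R)"
    using occurs_at_appendD(1)[OF r0] occurs_at_appendD(1)[OF r1] occurs_at_appendD(1)[OF r2]
      occurs_at_appendD(1)[OF r3] occurs_at_appendD(1)[OF r4] r5 by simp_all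
qed

lemma occurs_header:
  "occurs_at layout (E + 1) (nat_bits E E)" "occurs_at layout (2 * E + 1) (nat_bits E L)"
  "occurs_at layout (3 * E + 1) (nat_bits g p)"
  "occurs_at layout (3 * E + 1 + g) (nat_bits g (low_pos div w))"
  "occurs_at layout (3 * E + 1 + 2 * g) (nat_bits g (low_pos mod w))"
proof -
  note D = occurs_at_appendD(2)
  have pos: "0 + length (replicate E False) + length [True] = E + 1"
    "E + 1 + length (nat_bits E E) = 2 * E + 1" "2 * E + 1 + length (nat_bits E L) = 3 * E + 1"
    "3 * E + 1 + length (nat_bits g p) = 3 * E + 1 + g"
    "3 * E + 1 + g + length (nat_bits g (low_pos div w)) = 3 * E + 1 + 2 * g"
    by simp_all
  note r1 = D[OF D[OF occurs_parts(1)[unfolded header_def]], unfolded pos(1)]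
  note r2 = D[OF r1, unfolded pos(2)]
  note r3 = D[OF r2, unfolded pos(3)]
  note r4 = D[OF r3, unfolded pos(4)]
  note r5 = D[OF r4, unfolded pos(5)]
  show "occurs_at layout (E + 1) (nat_bits E E)" using occurs_at_appendD(1)[OF r1] .
  show "occurs_at layout (2 * E + 1) (nat_bits E L)" using occurs_at_appendD(1)[OF r2] .
  show "occurs_at layout (3 * E + 1) (nat_bits g p)" using occurs_at_appendD(1)[OF r3] .
  show "occurs_at layout (3 * E + 1 + g) (nat_bits g (low_pos div w))"
    using occurs_at_appendD(1)[OF r4] .
  show "occurs_at layout (3 * E + 1 + 2 * g) (nat_bits g (low_pos mod w))" using r5 .
qed

lemma occurs_dir_entry:
  assumes "j < J"
  shows "occurs_at layout (dir_base + j * (4 * g) + 0 * g) (nat_bits g (sb_pos j div w))"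
    "occurs_at layout (dir_base + j * (4 * g) + 1 * g) (nat_bits g (sb_pos j mod w))"
    "occurs_at layout (dir_base + j * (4 * g) + 2 * g) (nat_bits g (z (j * b1)))"
    "occurs_at layout (dir_base + j * (4 * g) + 3 * g) (nat_bits g (of_bool (bs.escaped j)))"
proof -
  have "occurs_at layout (dir_base + (\<Sum>j'<j. length (dir_entry j'))) (dir_entry j)"
    using occurs_at_concat_map[OF occurs_parts(2)[unfolded directory_def] assms] .
  moreover have "(\<Sum>j'<j. length (dir_entry j')) = j * (4 * g)" by (simp add: dir_entry_def)
  ultimately have r0: "occurs_at layout (dir_base + j * (4 * g)) (dir_entry j)" by simp
  note D = occurs_at_appendD(2)
  define s where "s = dir_base + j * (4 * g)"
  have pos: "s + length (nat_bits g a) = s + 1 * g" "s + 1 * g + length (nat_bits g a) = s + 2 * g"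
    "s + 2 * g + length (nat_bits g a) = s + 3 * g" for a
    by simp_all
  note r0' = r0[unfolded dir_entry_def, folded s_def]
  note r1 = D[OF r0', unfolded pos]
  note r2 = D[OF r1, unfolded pos]
  note r3 = D[OF r2, unfolded pos]
  show "occurs_at layout (dir_base + j * (4 * g) + 0 * g) (nat_bits g (sb_pos j div w))"
    using occurs_at_appendD(1)[OF r0'] unfolding s_def by simp
  show "occurs_at layout (dir_base + j * (4 * g) + 1 * g) (nat_bits g (sb_pos j mod w))"
    using occurs_at_appendD(1)[OF r1] unfolding s_def .
  show "occurs_at layout (dir_base + j * (4 * g) + 2 * g) (nat_bits g (z (j * b1)))"
    using occurs_at_appendD(1)[OF r2] unfolding s_def .
  show "occurs_at layout (dir_base + j * (4 * g) + 3 * g) (nat_bits g (of_bool (bs.escaped j)))"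
    using r3 unfolding s_def .
qed

lemma occurs_table:
  assumes "k < tab_len"
  shows "occurs_at layout (tab_base + k * \<gamma>) (nat_bits \<gamma> (bs.table_entry k))"
  using occurs_at_concat_map[OF occurs_parts(3)[unfolded table_def] assms] by simp

lemma occurs_superblock: "j < J \<Longrightarrow> occurs_at layout (sb_pos j) (bs.superblock j)"
  unfolding sb_pos_def using occurs_at_concat_map[OF occurs_parts(4)[unfolded zdata_def]] .

lemma occurs_low: "k < n \<Longrightarrow> occurs_at layout (low_pos + k * \<kappa>) (nat_bits \<kappa> (x k))"
  using occurs_at_concat_map[OF occurs_parts(5)[unfolded lows_def], of k] by simp

lemma residue_less: "residue k < q" using q_pos by (simp add: residue_def)

lemma R_less: "R < 2 ^ r_len"
proof -
  have "R < q ^ n" unfolding R_def by (intro radix_less residue_less)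
  also have "\<dots> \<le> 2 ^ r_len" using choose_le_code_len[of "q ^ n" 1] by (simp add: r_len_def)
  finally show ?thesis .
qed

lemma drop_bit_R: "drop_bit (low_pos + n * \<kappa>) (bits_val layout) = R"
proof -
  let ?pre = "header @ directory @ table @ zdata @ lows"
  have "length ?pre = low_pos + n * \<kappa>"
    by (simp add: length_header length_directory length_table length_lows z_base_def tab_base_def
        flip: length_zdata)
  moreover have "layout = ?pre @ nat_bits r_len R" by (simp add: layout_def)
  ultimately have "drop_bit (low_pos + n * \<kappa>) (bits_val layout) = bits_val (nat_bits r_len R)"
    using drop_bit_append[of ?pre "nat_bits r_len R"] by simp
  then show ?thesis
    using R_less by (simp add: nat_bits_def horner_sum_bit_eq_take_bit take_bit_nat_eq_self)
qed

section \<open>Length of the layout\<close>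

lemma g_le: "g \<le> w" "g \<le> ptr_width K n" by (auto simp: g_def)

lemma less_g: "a < 2 ^ w \<Longrightarrow> a < 2 ^ ptr_width K n \<Longrightarrow> a < 2 ^ g"
  by (simp add: g_def min_def)

lemma z_base_le: "z_base \<le> index_size K n"
proof -
  have "3 * g \<le> 3 * ptr_width K n" "J * (4 * g) \<le> (n div b1 + 1) * (4 * ptr_width K n)"
    unfolding J_def using g_le(2) by (intro mult_le_mono2; simp)+
  then show ?thesis
    unfolding z_base_def tab_base_def dir_base_def index_size_def tab_len_def by linarith
qed

text \<open>The term \<open>n div b0\<close> on the left is held in reserve: \<open>overhead\<close>
  contains it to pay for the rounding in \<open>sum_block_len_le\<close>.\<close>

lemma low_pos_le:
  "low_pos + n div b0 \<le> overhead K n + (\<Sum>k<n div b0. bs.block_len (k * b0))"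
proof -
  have "(U div extent_bound n + 1) * (b1 * g)
      \<le> (6 * n * L div extent_bound n + 1) * (b1 * ptr_width K n)"
    using U_less g_le(2) by (intro mult_le_mono add_mono div_le_mono) auto
  then have "low_pos \<le> z_base + (6 * n * L div extent_bound n + 1) * (b1 * ptr_width K n) +
      (n div b1 + 1) * (3 * \<gamma> * B) + (\<Sum>k<n div b0. bs.block_len (k * b0))"
    using bs.sum_length_superblock_le unfolding low_pos_def sb_pos_def J_def b1_eq by linarith
  then show ?thesis using z_base_le unfolding overhead_def data_excess_def by linarith
qed

text \<open>The crude \<open>2 ^ U\<close> bounds the binomial coefficient, which suffices for
  positions to fit into the pointers.\<close>

lemma low_pos_le_U: "low_pos \<le> overhead K n + U"
proof -
  have "2 ^ (\<Sum>k<n div b0. bs.block_len (k * b0)) \<le> 2 ^ (n div b0) * (U choose n)"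
    by (rule bs.sum_block_len_le)
  also have "\<dots> \<le> 2 ^ (n div b0) * 2 ^ U"
    by (intro mult_le_mono2) (rule binomial_le_pow2)
  finally have "(\<Sum>k<n div b0. bs.block_len (k * b0)) \<le> n div b0 + U"
    by (simp flip: power_add)
  then show ?thesis using low_pos_le by linarith
qed

lemma sb_pos_le: "j \<le> J \<Longrightarrow> sb_pos j \<le> low_pos"
  unfolding low_pos_def sb_pos_def by (intro add_left_mono sum_mono2) auto

text \<open>Codes account for \<open>U choose n\<close>, the low bits and \<open>R\<close> for
  \<open>Q ^ n\<close>, and \<open>choose_U_le\<close> leads back to \<open>m choose n\<close>. The
  1 is the rounding in \<open>r_len\<close>.\<close>

lemma length_layout_le:
  "real (length layout) \<le>
     log 2 (real (m choose n)) + (real (overhead K n) + 1 + 3 * real n / real L)"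
proof -
  let ?S = "\<Sum>k<n div b0. bs.block_len (k * b0)"
  have len: "length layout + n div b0 \<le> overhead K n + (?S + n * \<kappa> + r_len)"
    using low_pos_le length_zdata
    by (simp add: layout_def length_header length_directory length_table length_lows
        z_base_def tab_base_def)
  have "2 ^ r_len \<le> 2 * q ^ n"
    using code_len_tight[of 1 "q ^ n"] q_pos by (simp add: r_len_def)
  then have "2 ^ ?S * (2 ^ (n * \<kappa>) * 2 ^ r_len)
      \<le> 2 ^ (n div b0) * (U choose n) * (2 ^ (n * \<kappa>) * (2 * q ^ n))"
    by (intro mult_le_mono bs.sum_block_len_le) auto
  then have "2 ^ (?S + n * \<kappa> + r_len) \<le> 2 ^ (n div b0 + 1) * ((U choose n) * Q ^ n)"
    by (simp add: power_add Q_def power_mult_distrib power_mult[symmetric] algebra_simps)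
  then have "real (2 ^ (?S + n * \<kappa> + r_len)) \<le> real (2 ^ (n div b0 + 1) * ((U choose n) * Q ^ n))"
    by (simp only: of_nat_le_iff)
  also have "\<dots> = 2 ^ (n div b0 + 1) * (real (U choose n) * real Q ^ n)" by simp
  also have "\<dots> \<le> 2 ^ (n div b0 + 1) * (real (m choose n) * 2 powr (3 * real n / real L))"
    by (intro mult_left_mono choose_U_le) simp
  finally have "2 powr real (?S + n * \<kappa> + r_len)
      \<le> 2 powr real (n div b0 + 1) * (real (m choose n) * 2 powr (3 * real n / real L))"
    by (simp only: powr_realpow of_nat_power of_nat_numeral zero_less_numeral)
  moreover have pos: "0 < real (m choose n)" using n_le_m by simp
  ultimately have "real (?S + n * \<kappa> + r_len)
      \<le> log 2 (2 powr real (n div b0 + 1) * (real (m choose n) * 2 powr (3 * real n / real L)))"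
    by (simp add: le_log_iff)
  also have "\<dots> = real (n div b0 + 1) + (log 2 (real (m choose n)) + 3 * real n / real L)"
    using pos by (simp add: log_mult)
  finally have "real (?S + n * \<kappa> + r_len)
      \<le> real (n div b0) + 1 + log 2 (real (m choose n)) + 3 * real n / real L" by simp
  moreover have "real (length layout) + real (n div b0) \<le> real (overhead K n) + real (?S + n * \<kappa> + r_len)"
    using len by (metis of_nat_add of_nat_le_iff)
  ultimately show ?thesis by linarith
qed

end

section \<open>The query program\<close>

text \<open>Nothing is shared between subexpressions: recomputation only enlarges a constant that
  depends on \<open>K\<close> and \<open>W\<close> alone.\<close>

definition x_word0 :: expr where "x_word0 = Fetch (Lit 0)"
text \<open>The first word starts with \<open>e\<close> zeros and a one; subtracting \<open>1\<close> flips exactly these bits.\<close>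

definition x_pow :: expr where
  "x_pow = Bin Div (Bin Add (Bin Xor x_word0 (Bin Sub x_word0 (Lit 1))) (Lit 1)) (Lit 2)"
definition x_level :: expr where
  "x_level = Bin Mod (Bin Div x_word0 (Bin Mul (Lit 2) x_pow)) x_pow"
definition x_len :: expr where
  "x_len = Read (Lit 0) (Bin Add (Bin Mul (Lit 2) x_level) (Lit 1)) x_level"
definition x_field :: expr where "x_field = Bin Mul (Lit 10) x_level"
definition x_block :: expr where "x_block = Bin Mul x_level x_level"
definition x_window :: expr where "x_window = Bin Mul (Lit 5) (Bin Mul x_block x_level)"
definition x_super :: expr where "x_super = Bin Mul x_block (Bin Mul x_len x_len)"
definition x_ptr :: "nat \<Rightarrow> expr" where "x_ptr K = Bin Add (Bin Mul (Lit 3) x_len) (Lit K)"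
definition x_g :: "nat \<Rightarrow> expr" where "x_g K = If_Less (Var 3) (x_ptr K) (Var 3) (x_ptr K)"
definition x_hdr :: expr where "x_hdr = Bin Add (Bin Mul (Lit 3) x_level) (Lit 1)"
definition x_hdr_field :: "nat \<Rightarrow> nat \<Rightarrow> expr" where
  "x_hdr_field K c = Read (Lit 0) (Bin Add x_hdr (Bin Mul (Lit c) (x_g K))) (x_g K)"
definition x_dir :: "nat \<Rightarrow> expr" where "x_dir K = Bin Add x_hdr (Bin Mul (Lit 3) (x_g K))"
definition x_idx :: expr where "x_idx = Bin Sub (Var 0) (Lit 1)"
definition x_tab :: "nat \<Rightarrow> expr" where
  "x_tab K = Bin Add (x_dir K)
     (Bin Mul (Bin Add (Bin Div (Var 1) x_super) (Lit 1)) (Bin Mul (Lit 4) (x_g K)))"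
definition x_entry :: "nat \<Rightarrow> nat \<Rightarrow> expr" where
  "x_entry K c = Read (Lit 0)
     (Bin Add (Bin Add (x_dir K) (Bin Mul (Bin Div x_idx x_super) (Bin Mul (Lit 4) (x_g K))))
        (Bin Mul (Lit c) (x_g K))) (x_g K)"
definition x_rem :: expr where "x_rem = Bin Mod x_idx x_super"
definition x_rec :: "nat \<Rightarrow> nat \<Rightarrow> expr" where
  "x_rec K c = Read (x_entry K 0)
     (Bin Add (x_entry K 1)
       (Bin Add (Bin Mul (Bin Div x_rem x_block) (Bin Mul (Lit 3) x_field))
          (Bin Mul (Lit c) x_field))) x_field"
definition x_code :: "nat \<Rightarrow> expr" where
  "x_code K = Read (x_entry K 0) (Bin Add (x_entry K 1) (x_rec K 0)) x_window"
definition x_off :: "nat \<Rightarrow> expr" where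
  "x_off K = Read (Lit 0)
     (Bin Add (x_tab K)
       (Bin Mul
         (Bin Add (Bin Mul (Bin Add (Bin Mul (x_rec K 2) (Pow2 x_window)) (x_code K)) x_block)
           (Bin Mod x_rem x_block))
         x_field)) x_field"
definition x_z :: "nat \<Rightarrow> expr" where
  "x_z K = If_Less (Lit 0) (x_entry K 3)
     (Read (x_entry K 0) (Bin Add (x_entry K 1) (Bin Mul x_rem (x_g K))) (x_g K))
     (Bin Add (x_entry K 2) (Bin Add (x_rec K 1) (x_off K)))"
text \<open>Division replaces the comparison of \<open>m\<close> with \<open>4 * n * L\<close>, a
  product that might overflow.\<close>

definition x_if_dense :: "expr \<Rightarrow> expr \<Rightarrow> expr" where
  "x_if_dense a b = If_Less (Bin Div (Var 2) (Bin Mul (Lit 4) x_len)) (Var 1) a b"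
definition x_D :: expr where
  "x_D = x_if_dense (Var 2) (Bin Mul (Bin Mul (Lit 2) (Var 1)) x_len)"
definition x_Y :: "nat \<Rightarrow> expr" where "x_Y K = x_if_dense (x_z K) (Bin Sub (x_z K) x_idx)"
definition x_h :: expr where
  "x_h = Bin Add
     (Bin Div (Bin Div (Bin Div (Bin Div (Var 3) (Lit 16)) (Var 1)) (Var 1)) (Var 1)) (Lit 1)"
definition x_kappa :: "nat \<Rightarrow> expr" where "x_kappa K = Bin Mul (x_hdr_field K 0) x_h"
definition x_q :: "nat \<Rightarrow> expr" where
  "x_q K = Bin Div (Bin Div (Var 2) (Pow2 (x_kappa K))) x_D"
definition x_low :: "nat \<Rightarrow> expr" where
  "x_low K = Read (x_hdr_field K 1)
     (Bin Add (x_hdr_field K 2) (Bin Mul x_idx (x_kappa K))) (x_kappa K)"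
definition x_R :: "nat \<Rightarrow> expr" where
  "x_R K = Read (x_hdr_field K 1)
     (Bin Add (x_hdr_field K 2) (Bin Mul (Var 1) (x_kappa K))) (Var 3)"
definition x_v :: expr where "x_v = Bin Add (Bin Mul x_h (Var 1)) (Lit 1)"
definition x_residue :: "nat \<Rightarrow> expr" where
  "x_residue K = Bin Mod
     (Bin Div (x_R K) (Bin Mod (Pow2 (Bin Mul x_v x_idx)) (Bin Sub (Pow2 x_v) (x_q K)))) (x_q K)"
definition x_elem :: "nat \<Rightarrow> expr" where
  "x_elem K = Bin Add
     (Bin Mul (Bin Add (Bin Mul (x_Y K) (x_q K)) (x_residue K)) (Pow2 (x_kappa K))) (x_low K)"

lemma vars_x_base:
  "vars x_word0 \<subseteq> {..<4}" "vars x_pow \<subseteq> {..<4}" "vars x_level \<subseteq> {..<4}" "vars x_len \<subseteq> {..<4}"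
  "vars x_field \<subseteq> {..<4}" "vars x_block \<subseteq> {..<4}" "vars x_window \<subseteq> {..<4}" "vars x_super \<subseteq> {..<4}"
  "vars (x_ptr K) \<subseteq> {..<4}" "vars (x_g K) \<subseteq> {..<4}" "vars x_hdr \<subseteq> {..<4}"
  "vars (x_hdr_field K c) \<subseteq> {..<4}" "vars (x_dir K) \<subseteq> {..<4}" "vars x_idx \<subseteq> {..<4}"
  "vars (x_tab K) \<subseteq> {..<4}" "vars (x_entry K c) \<subseteq> {..<4}" "vars x_rem \<subseteq> {..<4}"
  by (simp_all add: x_word0_def x_pow_def x_level_def x_len_def x_field_def x_block_def x_window_def
  x_super_def x_ptr_def x_g_def x_hdr_def x_hdr_field_def x_dir_def x_idx_def x_tab_def x_entry_def
  x_rem_def)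

lemma vars_x_mid:
  "vars (x_rec K c) \<subseteq> {..<4}" "vars (x_code K) \<subseteq> {..<4}" "vars (x_off K) \<subseteq> {..<4}"
  "vars (x_z K) \<subseteq> {..<4}" "vars x_D \<subseteq> {..<4}" "vars (x_Y K) \<subseteq> {..<4}" "vars x_h \<subseteq> {..<4}"
  "vars (x_kappa K) \<subseteq> {..<4}"
  by (simp_all add: vars_x_base x_rec_def x_code_def x_off_def x_z_def x_if_dense_def x_D_def
      x_Y_def x_h_def x_kappa_def)

lemma vars_x_elem: "vars (x_elem K) \<subseteq> {..<4}"
  by (simp add: vars_x_base vars_x_mid x_q_def x_low_def x_R_def x_v_def x_residue_def x_elem_def)

locale elements_query = elements +
  fixes i :: nat
  assumes i_bounds: "1 \<le> i" "i \<le> n"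
begin

sublocale qr: query w n m i layout
  using w_large by unfold_locales auto

abbreviation ev :: "expr \<Rightarrow> nat" where "ev \<equiv> qr.ev"
abbreviation k :: nat where "k \<equiv> i - 1"

lemma k_less: "k < n" using i_bounds by simp

section \<open>Evaluating header and directory expressions\<close>

lemma two_w_large: "256 \<le> (2::nat) ^ w"
  using w_large less_exp[of w] by linarith

lemma small: "a \<le> overhead K n \<Longrightarrow> a < 2 ^ w"
proof -
  assume "a \<le> overhead K n"
  moreover have "0 < (2::nat) ^ w" by simp
  ultimately show ?thesis using overhead_word by linarith
qed

lemma index_bounds:
  "3 * E + 1 + 7 * ptr_width K n \<le> overhead K n" "2 ^ \<gamma> * 2 ^ \<delta> * b0 * \<gamma> \<le> overhead K n"
  "b1 * ptr_width K n \<le> overhead K n" "3 * \<gamma> * B \<le> overhead K n" "z_base \<le> overhead K n"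
proof -
  have "4 * ptr_width K n \<le> (n div b1 + 1) * (4 * ptr_width K n)" by simp
  then show "3 * E + 1 + 7 * ptr_width K n \<le> overhead K n"
    unfolding overhead_def index_size_def by linarith
  show "2 ^ \<gamma> * 2 ^ \<delta> * b0 * \<gamma> \<le> overhead K n" by (simp add: overhead_def index_size_def)
  have "b1 * ptr_width K n \<le> (6 * n * L div extent_bound n + 1) * (b1 * ptr_width K n)" by simp
  then show "b1 * ptr_width K n \<le> overhead K n" unfolding overhead_def data_excess_def by linarith
  have "3 * \<gamma> * B \<le> (n div b1 + 1) * (3 * \<gamma> * B)" by simp
  then show "3 * \<gamma> * B \<le> overhead K n" unfolding overhead_def data_excess_def by linarith
  show "z_base \<le> overhead K n" using z_base_le by (simp add: overhead_def)
qed

lemma ptr_pos: "1 \<le> ptr_width K n" using K_ge by (simp add: ptr_width_def)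

lemma field_pos: "10 \<le> \<gamma>" using E_pos by (simp add: field_width_def)

lemma b0_pos: "1 \<le> b0" using E_pos by (simp add: block_size_def)

lemma pow_bounds: "2 ^ \<gamma> \<le> overhead K n" "2 ^ \<delta> \<le> overhead K n" "b0 \<le> overhead K n"
  "\<gamma> < w" "\<delta> < w" "2 * E + 1 < w" "b1 \<le> overhead K n" "L * L \<le> overhead K n" "E < w"
  "\<delta> \<le> overhead K n" "\<gamma> \<le> overhead K n"
proof -
  have "2 ^ \<gamma> * 1 * 1 * 1 \<le> 2 ^ \<gamma> * 2 ^ \<delta> * b0 * \<gamma>" "1 * 2 ^ \<delta> * 1 * 1 \<le> 2 ^ \<gamma> * 2 ^ \<delta> * b0 * \<gamma>"
    "1 * 1 * b0 * 1 \<le> 2 ^ \<gamma> * 2 ^ \<delta> * b0 * \<gamma>"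
    using b0_pos field_pos by (intro mult_le_mono; simp)+
  then show 1: "2 ^ \<gamma> \<le> overhead K n" "2 ^ \<delta> \<le> overhead K n" "b0 \<le> overhead K n"
    using index_bounds(2) by linarith+
  show "\<gamma> < w" "\<delta> < w" using small[OF 1(1)] small[OF 1(2)] by simp_all
  then show "2 * E + 1 < w" using E_pos by (simp add: field_width_def)
  then show "E < w" by simp
  have "b1 * 1 \<le> b1 * ptr_width K n" using ptr_pos by (intro mult_le_mono) auto
  then show b1: "b1 \<le> overhead K n" using index_bounds(3) by linarith
  have "1 * (L * L) \<le> b1" unfolding super_size_def block_count_def
    using b0_pos by (intro mult_le_mono) auto
  then show "L * L \<le> overhead K n" using b1 by linarith
  show "\<delta> \<le> overhead K n" "\<gamma> \<le> overhead K n" using 1 less_exp[of \<delta>] less_exp[of \<gamma>] by linarith+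
qed

text \<open>Header, directory and table are short enough for a bit position to fit into a register,
  so the base address is word 0.\<close>

lemma read_index:
  assumes "ev t = y" "ev d = c" "y \<le> overhead K n" "c \<le> w"
    "occurs_at layout y (nat_bits c v)" "v < 2 ^ c"
  shows "ev (Read (Lit 0) t d) = v"
proof (rule qr.ev_Read_field[OF _ assms(1,2) _ assms(4) _ assms(6)])
  show "ev (Lit 0) = 0" by simp
  have "y div w \<le> y" by (rule div_le_dividend)
  then show "0 + y div w + 1 < 2 ^ w" using assms(3) overhead_word two_w_large by linarith
  show "occurs_at layout (0 * w + y) (nat_bits c v)" using assms(5) by simp
qed

lemma ev_word0: "ev x_word0 = take_bit w (bits_val layout)"
  by (simp add: x_word0_def pack_eq)

lemma word0: "take_bit w (bits_val layout)
    = 2 ^ E + 2 ^ Suc E * (take_bit w (bits_val layout) div 2 ^ Suc E)"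
  and word0_level: "take_bit w (bits_val layout) div 2 ^ Suc E mod 2 ^ E = E"
proof -
  let ?X = "take_bit w (bits_val layout)"
  obtain r where r: "layout = replicate E False @ True # r"
    by (auto simp: layout_def header_def)
  have "?X mod 2 ^ Suc E = take_bit (Suc E) (bits_val layout)"
    using pow_bounds(6) unfolding take_bit_eq_mod[symmetric] take_bit_take_bit by (simp add: min_def)
  also have "\<dots> = 2 ^ E"
    unfolding r bits_val_unary take_bit_eq_mod by simp
  finally have "?X mod 2 ^ Suc E = 2 ^ E" .
  then show "?X = 2 ^ E + 2 ^ Suc E * (?X div 2 ^ Suc E)"
    by (metis mod_mult_div_eq)
  have "?X div 2 ^ Suc E mod 2 ^ E = take_bit E (drop_bit (Suc E) ?X)"
    by (simp only: take_bit_eq_mod drop_bit_eq_div)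
  also have "\<dots> = take_bit E (drop_bit (E + 1) (bits_val layout))"
    using pow_bounds(6) by (intro bit_eqI) (auto simp: bit_take_bit_iff bit_drop_bit_eq)
  also have "\<dots> = E" by (rule read_field[OF occurs_header(1)]) simp
  finally show "?X div 2 ^ Suc E mod 2 ^ E = E" .
qed

lemma ev_pow: "ev x_pow = 2 ^ E"
proof -
  let ?X = "take_bit w (bits_val layout)"
  have X: "ev x_word0 = ?X" by (rule ev_word0)
  have X1: "1 \<le> ?X" using word0 by (metis add_gr_0 less_eq_nat.simps(1) One_nat_def Suc_leI zero_less_numeral zero_less_power)
  have "ev (Bin Sub x_word0 (Lit 1)) = ?X - 1"
    by (intro qr.ev_Sub X qr.ev_Lit_small X1 take_bit_nat_less_exp) simp
  then have "ev (Bin Xor x_word0 (Bin Sub x_word0 (Lit 1))) = 2 ^ Suc E - 1"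
    using X xor_pred[OF word0] by simp
  moreover have "(2::nat) ^ Suc E < 2 ^ w" using pow_bounds(6) E_pos by (intro power_strict_increasing) auto
  ultimately have "ev (Bin Add (Bin Xor x_word0 (Bin Sub x_word0 (Lit 1))) (Lit 1)) = 2 ^ Suc E - 1 + 1"
    by (intro qr.ev_Add qr.ev_Lit_small) auto
  then show ?thesis
    unfolding x_pow_def by (subst qr.ev_Div[OF _ qr.ev_Lit_small]) auto
qed

lemma ev_level: "ev x_level = E"
proof -
  have "(2::nat) ^ Suc E < 2 ^ w" using pow_bounds(6) E_pos by (intro power_strict_increasing) auto
  then have "ev (Bin Mul (Lit 2) x_pow) = 2 * 2 ^ E"
    by (intro qr.ev_Mul qr.ev_Lit_small ev_pow) auto
  then have "ev (Bin Div x_word0 (Bin Mul (Lit 2) x_pow)) = take_bit w (bits_val layout) div 2 ^ Suc E"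
    by (subst qr.ev_Div[OF ev_word0]) auto
  then show ?thesis
    unfolding x_level_def using word0_level by (subst qr.ev_Mod[OF _ ev_pow]) auto
qed

lemma ev_len: "ev x_len = L"
  unfolding x_len_def
proof (rule read_index[OF _ ev_level _ _ occurs_header(2)])
  have le: "2 * E + 1 \<le> overhead K n" using index_bounds(1) by linarith
  show "ev (Bin Add (Bin Mul (Lit 2) x_level) (Lit 1)) = 2 * E + 1"
    using small[OF le] by (intro qr.ev_Add qr.ev_Mul qr.ev_Lit_small ev_level) auto
  show "2 * E + 1 \<le> overhead K n" by (rule le)
  show "E \<le> w" using pow_bounds by simp
  show "L < 2 ^ E" by (rule bit_length_less)
qed

lemma ev_field: "ev x_field = \<gamma>"
  unfolding x_field_def field_width_def
  using small[OF pow_bounds(11)] by (intro qr.ev_Mul qr.ev_Lit_small ev_level) (auto simp: field_width_def)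

lemma ev_block: "ev x_block = b0"
  unfolding x_block_def block_size_def
  using small[OF pow_bounds(3)] by (intro qr.ev_Mul ev_level) (auto simp: block_size_def)

lemma ev_window: "ev x_window = \<delta>"
proof -
  have eq: "\<delta> = 5 * (b0 * E)" by (simp add: window_width_def block_size_def)
  have "5 * (b0 * E) < 2 ^ w" using small[OF pow_bounds(10)] eq by simp
  then show ?thesis
    unfolding x_window_def eq by (intro qr.ev_Mul qr.ev_Lit_small ev_block ev_level) auto
qed

lemma ev_super: "ev x_super = b1"
  unfolding x_super_def super_size_def block_count_def
  using small[OF pow_bounds(7)] small[OF pow_bounds(8)]
  by (intro qr.ev_Mul ev_block ev_len) (auto simp: super_size_def block_count_def)

lemma ev_ptr: "ev (x_ptr K) = ptr_width K n"
proof -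
  have le: "ptr_width K n \<le> overhead K n" using index_bounds(1) by linarith
  show ?thesis
    unfolding x_ptr_def ptr_width_def
    using small[OF le]
    by (intro qr.ev_Add[OF qr.ev_Mul[OF qr.ev_Lit_small ev_len] qr.ev_Lit]) (auto simp: ptr_width_def)
qed

lemma ev_g: "ev (x_g K) = g"
  unfolding x_g_def g_def eval.simps(5) ev_ptr qr.ev_Var by (simp add: min_def)

lemma g_mult_le: "c \<le> 7 \<Longrightarrow> 3 * E + 1 + c * g \<le> overhead K n"
proof -
  assume "c \<le> 7"
  then have "c * g \<le> 7 * ptr_width K n" using g_le(2) by (intro mult_le_mono) auto
  then show ?thesis using index_bounds(1) by linarith
qed

lemma ev_hdr: "ev x_hdr = 3 * E + 1"
  unfolding x_hdr_def using small[OF g_mult_le[of 0]]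
  by (intro qr.ev_Add qr.ev_Mul qr.ev_Lit_small ev_level) auto

lemma ev_hdr_plus:
  assumes "c \<le> 7"
  shows "ev (Bin Add x_hdr (Bin Mul (Lit c) (x_g K))) = 3 * E + 1 + c * g"
  using small[OF g_mult_le[OF assms]] assms
  by (intro qr.ev_Add qr.ev_Mul qr.ev_Lit_small ev_hdr ev_g) auto

lemma pos_less_g:
  assumes "P \<le> low_pos"
  shows "P div w < 2 ^ g" "P mod w < 2 ^ g"
proof -
  have "P < 2 ^ ptr_width K n"
    using assms low_pos_le_U U_less overhead_ptr by linarith
  moreover have "P div w \<le> P" "P mod w \<le> P" by (rule div_le_dividend, rule mod_less_eq_dividend)
  ultimately have 1: "P div w < 2 ^ ptr_width K n" "P mod w < 2 ^ ptr_width K n" by linarith+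
  have "P mod w < w" using w_large by simp
  then have 2: "P mod w < 2 ^ w" using less_exp[of w] by linarith
  have "P < 2 * 2 ^ w"
    using assms low_pos_le_U U_le_m m_less overhead_word by linarith
  then have "P div w < 2 ^ w"
  proof -
    have "2 * 2 ^ w \<le> w * 2 ^ w" using w_large by (intro mult_le_mono1) auto
    then have "P < 2 ^ w * w" using \<open>P < 2 * 2 ^ w\<close> unfolding mult.commute[of "2 ^ w" w] by linarith
    then show ?thesis using w_large by (simp add: div_less_iff_less_mult)
  qed
  then show "P div w < 2 ^ g" "P mod w < 2 ^ g" using 1 2 by (auto intro: less_g)
qed

lemma ev_hdr_fields: "ev (x_hdr_field K 0) = p" "ev (x_hdr_field K 1) = low_pos div w"
  "ev (x_hdr_field K 2) = low_pos mod w"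
proof -
  show "ev (x_hdr_field K 0) = p"
    unfolding x_hdr_field_def
    using occurs_header(3) p_less g_mult_le[of 0] g_le
    by (intro read_index[OF ev_hdr_plus ev_g]) (auto intro: less_g)
  show "ev (x_hdr_field K 1) = low_pos div w"
    unfolding x_hdr_field_def
    using occurs_header(4) pos_less_g g_mult_le[of 1] g_le
    by (intro read_index[OF ev_hdr_plus ev_g]) auto
  show "ev (x_hdr_field K 2) = low_pos mod w"
    unfolding x_hdr_field_def
    using occurs_header(5) pos_less_g g_mult_le[of 2] g_le
    by (intro read_index[OF ev_hdr_plus ev_g]) auto
qed

lemma ev_dir: "ev (x_dir K) = dir_base"
  unfolding x_dir_def dir_base_def by (rule ev_hdr_plus) simp

lemma ev_idx: "ev x_idx = k"
  unfolding x_idx_def using i_bounds m_less n_le_m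
  by (intro qr.ev_Sub qr.ev_Lit_small qr.ev_Var) auto

lemma J_g_le: "dir_base + J * (4 * g) \<le> overhead K n"
  using index_bounds(5) unfolding z_base_def tab_base_def by linarith

lemma ev_tab: "ev (x_tab K) = tab_base"
proof -
  have "J * (4 * g) < 2 ^ w" "4 * g < 2 ^ w" "J < 2 ^ w" "dir_base + J * (4 * g) < 2 ^ w"
  proof -
    show "J * (4 * g) < 2 ^ w" "dir_base + J * (4 * g) < 2 ^ w" using small J_g_le by simp_all
    show "4 * g < 2 ^ w" using small g_mult_le[of 4] by simp
    have "J * 1 \<le> J * (4 * g)" using w_large ptr_pos by (intro mult_le_mono2) (auto simp: g_def)
    then show "J < 2 ^ w" using \<open>J * (4 * g) < 2 ^ w\<close> by linarith
  qed
  then show ?thesis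
    unfolding x_tab_def tab_base_def J_def
    by (intro qr.ev_Add qr.ev_Mul qr.ev_Div qr.ev_Lit_small ev_dir ev_super ev_g qr.ev_Var)
      (auto simp: J_def)
qed

definition j :: nat where "j = k div b1"

lemma j_less: "j < J" "j * b1 < n"
proof -
  have "k div b1 \<le> n div b1" using k_less by (intro div_le_mono) auto
  then show "j < J" by (simp add: j_def J_def)
  have "j * b1 \<le> k" by (simp add: j_def)
  then show "j * b1 < n" using k_less by simp
qed

lemma ev_entry_pos:
  assumes "c \<le> 3"
  shows "ev (Bin Add (Bin Add (x_dir K) (Bin Mul (Bin Div x_idx x_super) (Bin Mul (Lit 4) (x_g K))))
        (Bin Mul (Lit c) (x_g K))) = dir_base + j * (4 * g) + c * g"
    and "dir_base + j * (4 * g) + c * g \<le> overhead K n"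
proof -
  have "j * (4 * g) + c * g \<le> j * (4 * g) + 4 * g" using assms by simp
  also have "\<dots> = (j + 1) * (4 * g)" by simp
  also have "\<dots> \<le> J * (4 * g)" using j_less(1) by (intro mult_le_mono1) simp
  finally have le: "dir_base + j * (4 * g) + c * g \<le> overhead K n" using J_g_le by linarith
  then show "dir_base + j * (4 * g) + c * g \<le> overhead K n" .
  note s = small[OF le]
  have "4 * g < 2 ^ w" using small g_mult_le[of 4] by simp
  moreover have "dir_base + j * (4 * g) < 2 ^ w" "j * (4 * g) < 2 ^ w" "c * g < 2 ^ w" using s by linarith+
  ultimately show "ev (Bin Add (Bin Add (x_dir K) (Bin Mul (Bin Div x_idx x_super) (Bin Mul (Lit 4) (x_g K))))
        (Bin Mul (Lit c) (x_g K))) = dir_base + j * (4 * g) + c * g"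
    using s assms unfolding j_def
    by (intro qr.ev_Add qr.ev_Mul qr.ev_Div qr.ev_Lit_small ev_dir ev_super ev_g ev_idx) auto
qed

lemma ev_entry: "ev (x_entry K 0) = sb_pos j div w" "ev (x_entry K 1) = sb_pos j mod w"
  "ev (x_entry K 2) = z (j * b1)" "ev (x_entry K 3) = of_bool (bs.escaped j)"
proof -
  note d = occurs_dir_entry[OF j_less(1)]
  have P: "sb_pos j \<le> low_pos" using j_less(1) by (intro sb_pos_le) simp
  show "ev (x_entry K 0) = sb_pos j div w"
    unfolding x_entry_def
    by (intro read_index[OF ev_entry_pos(1) ev_g ev_entry_pos(2) g_le(1) d(1)] pos_less_g P) auto
  show "ev (x_entry K 1) = sb_pos j mod w"
    unfolding x_entry_def
    by (intro read_index[OF ev_entry_pos(1) ev_g ev_entry_pos(2) g_le(1) d(2)] pos_less_g P) auto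
  show "ev (x_entry K 2) = z (j * b1)"
    unfolding x_entry_def
    using z_less[OF j_less(2)] U_le_g
    by (intro read_index[OF ev_entry_pos(1) ev_g ev_entry_pos(2) g_le(1) d(3)]) auto
  have "1 \<le> g" using w_large ptr_pos by (simp add: g_def)
  then have "1 < (2::nat) ^ g" by (intro one_less_power) auto
  then have "(of_bool (bs.escaped j) :: nat) < 2 ^ g" by auto
  then show "ev (x_entry K 3) = of_bool (bs.escaped j)"
    unfolding x_entry_def
    by (intro read_index[OF ev_entry_pos(1) ev_g ev_entry_pos(2) g_le(1) d(4)]) auto
qed

text \<open>\<open>P\<close> itself may exceed a word, its two parts do not. The bound on
  \<open>y\<close> keeps \<open>P mod w + y\<close> from overflowing, and \<open>256 \<le> w\<close>
  keeps the word address small.\<close>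

lemma read_data:
  assumes "ev a = P div w" "ev b = P mod w" "ev t = y" "ev d = c" "P \<le> low_pos"
    "y \<le> 2 ^ w div 2" "c \<le> w"
  shows "ev (Read a (Bin Add b t) d) = take_bit c (drop_bit (P + y) (bits_val layout))"
proof -
  let ?T = "2 ^ w :: nat"
  have "w - 1 < 2 ^ (w - 1)" by simp
  moreover have "?T = 2 * 2 ^ (w - 1)" using w_large by (cases w) auto
  ultimately have w2: "w \<le> ?T div 2" by linarith
  have r: "P mod w < w" using w_large by simp
  have sum: "P mod w + y < ?T" using r w2 assms(6) by linarith
  have "P \<le> overhead K n + U" using assms(5) low_pos_le_U by linarith
  then have P: "8 * P \<le> 9 * ?T" using overhead_word U_le_m m_less by linarith
  have "P div w \<le> P div 256" using w_large by (intro div_le_mono2) auto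
  moreover have "(P mod w + y) div w \<le> (P mod w + y) div 256" using w_large by (intro div_le_mono2) auto
  moreover have "8 * (P div 256) \<le> ?T" using P by linarith
  moreover have "256 * ((P mod w + y) div 256) \<le> ?T" using sum by linarith
  ultimately have "P div w + (P mod w + y) div w + 1 < ?T" using two_w_large by linarith
  then have "ev (Read a (Bin Add b t) d)
      = take_bit c (drop_bit (P div w * w + (P mod w + y)) (bits_val layout))"
    using assms sum by (intro qr.ev_Read qr.ev_Add) auto
  then show ?thesis by (simp add: add.assoc[symmetric])
qed

lemma read_data_field:
  assumes "ev a = P div w" "ev b = P mod w" "ev t = y" "ev d = c" "P \<le> low_pos"
    "y \<le> 2 ^ w div 2" "c \<le> w" "occurs_at layout (P + y) (nat_bits c v)" "v < 2 ^ c"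
  shows "ev (Read a (Bin Add b t) d) = v"
  using read_data[OF assms(1-7)] read_field[OF assms(8,9)] by simp

lemma half: "a \<le> overhead K n \<Longrightarrow> a \<le> 2 ^ w div 2"
  using overhead_word by linarith

end

context elements_query
begin

definition rem :: nat where "rem = k mod b1"
definition blk :: nat where "blk = rem div b0"
definition pos_in_blk :: nat where "pos_in_blk = rem mod b0"
definition s :: nat where "s = bs.block_start j blk"

section \<open>Recovering an element of the increasing sequence\<close>

lemma b1_pos: "0 < b1" using bs.b1_pos by (simp add: b1_eq)

lemma rem_less: "rem < b1" using b1_pos by (simp add: rem_def)

lemma k_eq: "j * b1 + rem = k" by (simp add: j_def rem_def)

lemma blk_less: "blk < B"
  using rem_less b0_pos unfolding blk_def super_size_def
  by (simp add: div_less_iff_less_mult mult.commute)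

lemma s_eq: "s + pos_in_blk = k"
proof -
  have "blk * b0 + pos_in_blk = rem" by (simp add: blk_def pos_in_blk_def)
  then show ?thesis using k_eq by (simp add: s_def bs.block_start_def b1_eq add.assoc)
qed

lemma pos_less: "pos_in_blk < b0" using b0_pos by (simp add: pos_in_blk_def)

lemma ev_rem: "ev x_rem = rem"
  unfolding x_rem_def rem_def by (rule qr.ev_Mod[OF ev_idx ev_super])

lemma sb_pos_j_le: "sb_pos j \<le> low_pos"
  using j_less(1) by (intro sb_pos_le) simp

lemma ev_z_escaped:
  assumes "bs.escaped j"
  shows "ev (Read (x_entry K 0) (Bin Add (x_entry K 1) (Bin Mul x_rem (x_g K))) (x_g K)) = z k"
proof (rule read_data_field[OF ev_entry(1,2) _ ev_g sb_pos_j_le _ g_le(1)])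
  have "rem * g \<le> b1 * ptr_width K n" using rem_less g_le(2) by (intro mult_le_mono) auto
  then have le: "rem * g \<le> overhead K n" using index_bounds(3) by linarith
  show "ev (Bin Mul x_rem (x_g K)) = rem * g" using small[OF le] by (intro qr.ev_Mul ev_rem ev_g)
  show "rem * g \<le> 2 ^ w div 2" using half[OF le] .
  have "rem < min bs.b1 (n - j * bs.b1)" using rem_less k_eq k_less by (simp add: b1_eq)
  from occurs_at_concat_map[OF _ this]
  show "occurs_at layout (sb_pos j + rem * g) (nat_bits g (z k))"
    using occurs_superblock[OF j_less(1)] assms k_eq
    unfolding bs.superblock_def by (fastforce simp: b1_eq)
  show "z k < 2 ^ g" using z_less[OF k_less] U_le_g by linarith
qed

context
  assumes ne: "\<not> bs.escaped j"
begin

lemmas block_facts = bs.not_escapedD[OF ne blk_less, folded s_def, unfolded b1_eq]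

lemma occurs_records:
  "occurs_at layout (sb_pos j) (concat (map (bs.block_record j) [0..<B]))"
  "occurs_at layout (sb_pos j + 3 * \<gamma> * B) (concat (map (\<lambda>b. bs.block_code (bs.block_start j b)) [0..<B]))"
proof -
  have at: "occurs_at layout (sb_pos j) (concat (map (bs.block_record j) [0..<B]) @
           concat (map (\<lambda>b. bs.block_code (bs.block_start j b)) [0..<B]))"
    using occurs_superblock[OF j_less(1)] ne unfolding bs.superblock_def by simp
  show "occurs_at layout (sb_pos j) (concat (map (bs.block_record j) [0..<B]))"
    using occurs_at_appendD(1)[OF at] .
  have "length (concat (map (bs.block_record j) [0..<B])) = 3 * \<gamma> * B"
    by (simp add: length_concat_map bs.block_record_def)
  then show "occurs_at layout (sb_pos j + 3 * \<gamma> * B)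
      (concat (map (\<lambda>b. bs.block_code (bs.block_start j b)) [0..<B]))"
    using occurs_at_appendD(2)[OF at] by simp
qed

lemma occurs_record:
  "occurs_at layout (sb_pos j + (blk * (3 * \<gamma>) + 0 * \<gamma>)) (nat_bits \<gamma> (bs.code_offset j blk))"
  "occurs_at layout (sb_pos j + (blk * (3 * \<gamma>) + 1 * \<gamma>)) (nat_bits \<gamma> (z s - z (j * b1)))"
  "occurs_at layout (sb_pos j + (blk * (3 * \<gamma>) + 2 * \<gamma>)) (nat_bits \<gamma> (bs.extent s b0))"
proof -
  define t where "t = sb_pos j + blk * (3 * \<gamma>)"
  have "(\<Sum>b<blk. length (bs.block_record j b)) = blk * (3 * \<gamma>)" by (simp add: bs.block_record_def)
  then have "occurs_at layout t (bs.block_record j blk)"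
    using occurs_at_concat_map[OF occurs_records(1) blk_less] by (simp add: t_def)
  then have r0: "occurs_at layout t (nat_bits \<gamma> (bs.code_offset j blk) @
     nat_bits \<gamma> (z s - z (j * b1)) @ nat_bits \<gamma> (bs.extent s b0))"
    by (simp add: bs.block_record_def s_def b1_eq)
  have pos: "t + length (nat_bits \<gamma> a) = t + \<gamma>" "t + \<gamma> + length (nat_bits \<gamma> a) = t + 2 * \<gamma>" for a
    by simp_all
  note r1 = occurs_at_appendD(2)[OF r0, unfolded pos]
  note r2 = occurs_at_appendD(2)[OF r1, unfolded pos]
  show "occurs_at layout (sb_pos j + (blk * (3 * \<gamma>) + 0 * \<gamma>)) (nat_bits \<gamma> (bs.code_offset j blk))"
    using occurs_at_appendD(1)[OF r0] by (simp add: t_def)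
  show "occurs_at layout (sb_pos j + (blk * (3 * \<gamma>) + 1 * \<gamma>)) (nat_bits \<gamma> (z s - z (j * b1)))"
    using occurs_at_appendD(1)[OF r1] by (simp add: t_def add.assoc)
  show "occurs_at layout (sb_pos j + (blk * (3 * \<gamma>) + 2 * \<gamma>)) (nat_bits \<gamma> (bs.extent s b0))"
    using r2 by (simp add: t_def add.assoc)
qed

lemma ev_rec:
  assumes "c \<le> 2" "occurs_at layout (sb_pos j + (blk * (3 * \<gamma>) + c * \<gamma>)) (nat_bits \<gamma> v)" "v < 2 ^ \<gamma>"
  shows "ev (x_rec K c) = v"
  unfolding x_rec_def
proof (rule read_data_field[OF ev_entry(1,2) _ ev_field sb_pos_j_le _ _ assms(2,3)])
  have "c * \<gamma> \<le> 3 * \<gamma>" using assms(1) by (intro mult_le_mono1) simp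
  then have "blk * (3 * \<gamma>) + c * \<gamma> \<le> (blk + 1) * (3 * \<gamma>)" unfolding distrib_right by linarith
  also have "\<dots> \<le> B * (3 * \<gamma>)" using blk_less by (intro mult_le_mono1) simp
  also have "\<dots> = 3 * \<gamma> * B" by simp
  finally have le: "blk * (3 * \<gamma>) + c * \<gamma> \<le> overhead K n" using index_bounds(4) by linarith
  have 3: "3 * \<gamma> < 2 ^ w"
  proof -
    have "3 * \<gamma> * 1 \<le> 3 * \<gamma> * B" using bs.B_pos by (intro mult_le_mono2) simp
    then have "3 * \<gamma> \<le> overhead K n" using index_bounds(4) by linarith
    then show ?thesis by (rule small)
  qed
  note sm = small[OF le]
  then have "blk * (3 * \<gamma>) < 2 ^ w" "c * \<gamma> < 2 ^ w" by linarith+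
  then show "ev (Bin Add (Bin Mul (Bin Div x_rem x_block) (Bin Mul (Lit 3) x_field)) (Bin Mul (Lit c) x_field))
      = blk * (3 * \<gamma>) + c * \<gamma>"
    using sm 3 assms(1) unfolding blk_def
    by (intro qr.ev_Add qr.ev_Mul qr.ev_Div ev_rem ev_block ev_field qr.ev_Lit_small) auto
  show "blk * (3 * \<gamma>) + c * \<gamma> \<le> 2 ^ w div 2" using half[OF le] .
  show "\<gamma> \<le> w" using pow_bounds(4) by simp
qed

lemma ev_recs: "ev (x_rec K 0) = bs.code_offset j blk" "ev (x_rec K 1) = z s - z (j * b1)"
  "ev (x_rec K 2) = bs.extent s b0"
proof -
  show "ev (x_rec K 0) = bs.code_offset j blk"
    by (rule ev_rec[OF _ occurs_record(1)]) (use block_facts in auto)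
  show "ev (x_rec K 1) = z s - z (j * b1)"
    by (rule ev_rec[OF _ occurs_record(2)]) (use block_facts bs.\<tau>_less in auto)
  show "ev (x_rec K 2) = bs.extent s b0"
    by (rule ev_rec[OF _ occurs_record(3)]) (use block_facts bs.\<tau>_less in auto)
qed

lemma ev_code: "ev (x_code K) < 2 ^ \<delta>" "ev (x_code K) mod 2 ^ bs.block_len s = bs.block_index s"
proof -
  have le: "bs.code_offset j blk \<le> overhead K n" using block_facts(6) pow_bounds(1) by linarith
  have eq: "ev (x_code K) = take_bit \<delta> (drop_bit (sb_pos j + bs.code_offset j blk) (bits_val layout))"
    unfolding x_code_def
    by (intro read_data ev_entry ev_recs ev_window sb_pos_j_le half[OF le]) (use pow_bounds(5) in auto)
  then show "ev (x_code K) < 2 ^ \<delta>" by simp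
  have "occurs_at layout (sb_pos j + 3 * \<gamma> * B + (\<Sum>b<blk. length (bs.block_code (bs.block_start j b))))
      (bs.block_code s)"
    unfolding s_def using occurs_at_concat_map[OF occurs_records(2) blk_less] .
  moreover have "sb_pos j + 3 * \<gamma> * B + (\<Sum>b<blk. length (bs.block_code (bs.block_start j b)))
      = sb_pos j + bs.code_offset j blk"
    by (simp add: bs.code_offset_def bs.block_code_def add.assoc)
  ultimately have "occurs_at layout (sb_pos j + bs.code_offset j blk) (bs.block_code s)"
    by (simp only:)
  then have "occurs_at layout (sb_pos j + bs.code_offset j blk)
      (nat_bits (bs.block_len s) (bs.block_index s))"
    unfolding bs.block_code_def .
  from read_occurs_at[OF this block_facts(5)]
  have "take_bit (bs.block_len s) (ev (x_code K)) = take_bit (bs.block_len s) (bs.block_index s)"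
    unfolding eq .
  then show "ev (x_code K) mod 2 ^ bs.block_len s = bs.block_index s"
    using bs.block_index(1)[OF block_facts(1)] by (simp add: take_bit_eq_mod)
qed

lemma ev_off: "ev (x_off K) = z k - z s"
proof -
  define t where "t = bs.extent s b0"
  define c where "c = ev (x_code K)"
  define e where "e = (t * 2 ^ \<delta> + c) * b0 + pos_in_blk"
  have c: "c < 2 ^ \<delta>" using ev_code(1) by (simp add: c_def)
  have t: "t < 2 ^ \<gamma>" using block_facts(2) bs.\<tau>_less by (simp add: t_def)
  have "t * 2 ^ \<delta> + c < (t + 1) * 2 ^ \<delta>" using c by simp
  also have "\<dots> \<le> 2 ^ \<gamma> * 2 ^ \<delta>" using t by (intro mult_le_mono1) simp
  finally have tc: "t * 2 ^ \<delta> + c + 1 \<le> 2 ^ \<gamma> * 2 ^ \<delta>" by simp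
  have "e < (t * 2 ^ \<delta> + c + 1) * b0" using pos_less by (simp add: e_def)
  also have "\<dots> \<le> tab_len" unfolding tab_len_def by (intro mult_le_mono1 tc)
  finally have e: "e < tab_len" .
  then have "e * \<gamma> \<le> tab_len * \<gamma>" by (intro mult_le_mono1) simp
  then have le: "tab_base + e * \<gamma> \<le> overhead K n" using index_bounds(5) unfolding z_base_def by linarith
  have val: "bs.table_entry e = z k - z s"
    unfolding e_def t_def
    using bs.table_entry_correct[OF block_facts(1) ev_code pos_less] s_eq by (simp add: c_def)
  have lt: "z k - z s < 2 ^ \<gamma>"
  proof -
    have "z k \<le> z (s + b0 - 1)"
      using s_eq pos_less block_facts(1) b0_pos by (intro bs.z_mono_le) auto
    then have "z k - z s < t" by (simp add: t_def bs.extent_def)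
    then show ?thesis using t by simp
  qed
  note sm = small[OF le]
  have "e * 1 \<le> e * \<gamma>" using field_pos by (intro mult_le_mono2) simp
  then have es: "e < 2 ^ w" "e * \<gamma> < 2 ^ w" using sm by linarith+
  have "t * 2 ^ \<delta> + c \<le> (t * 2 ^ \<delta> + c) * b0" using b0_pos by simp
  moreover have b: "(t * 2 ^ \<delta> + c) * b0 < 2 ^ w" using es(1) unfolding e_def by linarith
  ultimately have a: "t * 2 ^ \<delta> + c < 2 ^ w" by (rule le_less_trans)
  then have tb: "(t * 2 ^ \<delta> + c) * b0 < 2 ^ w" "t * 2 ^ \<delta> + c < 2 ^ w" "t * 2 ^ \<delta> < 2 ^ w"
    using b by linarith+
  have p: "ev (Pow2 x_window) = 2 ^ \<delta>" using pow_bounds(5) by (intro qr.ev_Pow2 ev_window)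
  have 1: "ev (Bin Add (Bin Mul (x_rec K 2) (Pow2 x_window)) (x_code K)) = t * 2 ^ \<delta> + c"
    using tb ev_recs(3) p by (intro qr.ev_Add qr.ev_Mul) (auto simp: t_def c_def)
  have m: "ev (Bin Mod x_rem x_block) = pos_in_blk"
    unfolding pos_in_blk_def by (intro qr.ev_Mod ev_rem ev_block)
  have 2: "ev (Bin Add (Bin Mul (Bin Add (Bin Mul (x_rec K 2) (Pow2 x_window)) (x_code K)) x_block)
           (Bin Mod x_rem x_block)) = e"
    unfolding e_def using tb es(1) by (intro qr.ev_Add[OF qr.ev_Mul[OF 1 ev_block] m]) (auto simp: e_def)
  have 3: "ev (Bin Add (x_tab K) (Bin Mul
         (Bin Add (Bin Mul (Bin Add (Bin Mul (x_rec K 2) (Pow2 x_window)) (x_code K)) x_block)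
           (Bin Mod x_rem x_block)) x_field)) = tab_base + e * \<gamma>"
    using sm es(2) by (intro qr.ev_Add[OF ev_tab qr.ev_Mul[OF 2 ev_field]])
  show ?thesis
    unfolding x_off_def
    using read_index[OF 3 ev_field le _ occurs_table[OF e]] pow_bounds(4) val lt by simp
qed

lemma ev_z_coded: "ev (Bin Add (x_entry K 2) (Bin Add (x_rec K 1) (x_off K))) = z k"
proof -
  have "z s \<le> z k" using s_eq k_less by (intro bs.z_mono_le) auto
  then have eq: "z (j * b1) + ((z s - z (j * b1)) + (z k - z s)) = z k"
    using block_facts(4) by simp
  have zk: "z k < 2 ^ w" using z_less[OF k_less] U_le_m m_less by linarith
  then have "ev (Bin Add (x_entry K 2) (Bin Add (x_rec K 1) (x_off K)))
      = z (j * b1) + ((z s - z (j * b1)) + (z k - z s))"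
    using eq by (intro qr.ev_Add ev_entry ev_recs ev_off) linarith+
  then show ?thesis using eq by simp
qed

end

lemma ev_z: "ev (x_z K) = z k"
proof -
  have "ev (Lit 0) = 0" by simp
  then show ?thesis
    unfolding x_z_def eval.simps(5) ev_entry(4)
    using ev_z_escaped ev_z_coded by (cases "bs.escaped j") (simp_all del: eval.simps)
qed

lemma ev_if_dense: "ev (x_if_dense a b) = (if dense then ev a else ev b)"
proof -
  have "4 * L \<le> 7 * ptr_width K n" by (simp add: ptr_width_def)
  then have "4 * L < 2 ^ w" using index_bounds(1) by (intro small) linarith
  then have "ev (Bin Div (Var 2) (Bin Mul (Lit 4) x_len)) = m div (4 * L)"
    by (intro qr.ev_Div qr.ev_Mul qr.ev_Lit_small ev_len qr.ev_Var) auto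
  then show ?thesis
    unfolding x_if_dense_def eval.simps(5) qr.ev_Var dense_def by simp
qed

lemma ev_D: "ev x_D = D"
proof (cases dense)
  case True
  then show ?thesis unfolding x_D_def ev_if_dense D_def by (simp add: qr.ev_Var del: eval.simps)
next
  case False
  have "2 * n * L < 2 ^ w" using D_le m_less False by (simp add: D_def)
  moreover have "2 * n * 1 \<le> 2 * n * L" using L_pos by (intro mult_le_mono2)
  ultimately have "ev (Bin Mul (Bin Mul (Lit 2) (Var 1)) x_len) = 2 * n * L"
    by (intro qr.ev_Mul qr.ev_Lit_small ev_len qr.ev_Var) linarith+
  then show ?thesis unfolding x_D_def ev_if_dense D_def using False by simp
qed

lemma ev_Y: "ev (x_Y K) = x k div Q"
proof (cases dense)
  case True
  then show ?thesis unfolding x_Y_def ev_if_dense using ev_z by (simp add: z_def del: eval.simps)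
next
  case False
  have zk: "z k < 2 ^ w" using z_less[OF k_less] U_le_m m_less by linarith
  have "ev (Bin Sub (x_z K) x_idx) = z k - k"
    using False zk by (intro qr.ev_Sub ev_z ev_idx) (auto simp: z_def)
  then show ?thesis unfolding x_Y_def ev_if_dense using False by (simp add: z_def del: eval.simps)
qed

lemma ev_h: "ev x_h = h"
proof -
  have "w div 16 div n div n div n \<le> w"
    by (meson div_le_dividend le_trans)
  moreover have "w + 1 < 2 ^ w"
  proof -
    have "w - 1 < 2 ^ (w - 1)" by simp
    moreover have "(2::nat) ^ w = 2 * 2 ^ (w - 1)" using w_large by (cases w) auto
    ultimately show ?thesis using w_large by linarith
  qed
  ultimately show ?thesis
    unfolding x_h_def h_def by (intro qr.ev_Add qr.ev_Div qr.ev_Lit_small qr.ev_Var) auto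
qed

lemma ev_kappa: "ev (x_kappa K) = \<kappa>"
  using less_trans[OF \<kappa>_bounds(1) less_exp] unfolding x_kappa_def \<kappa>_def
  by (intro qr.ev_Mul ev_hdr_fields ev_h)

lemma ev_pow_kappa: "ev (Pow2 (x_kappa K)) = 2 ^ \<kappa>"
  by (intro qr.ev_Pow2 ev_kappa \<kappa>_bounds)

lemma ev_q: "ev (x_q K) = q"
  unfolding x_q_def q_def by (intro qr.ev_Div ev_pow_kappa ev_D qr.ev_Var)

lemma ev_low: "ev (x_low K) = x k mod 2 ^ \<kappa>"
proof -
  have "k * \<kappa> \<le> n * \<kappa>" using k_less by (intro mult_le_mono1) simp
  then have le: "k * \<kappa> \<le> 2 ^ w div 2" using \<kappa>_bounds(2) by linarith
  moreover have "2 ^ w div 2 < (2::nat) ^ w" by simp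
  ultimately have "k * \<kappa> < 2 ^ w" by linarith
  then have t: "ev (Bin Mul x_idx (x_kappa K)) = k * \<kappa>" by (intro qr.ev_Mul ev_idx ev_kappa)
  have "ev (x_low K) = take_bit \<kappa> (drop_bit (low_pos + k * \<kappa>) (bits_val layout))"
    unfolding x_low_def
    using \<kappa>_bounds(1) by (intro read_data ev_hdr_fields t ev_kappa le) auto
  also have "\<dots> = take_bit \<kappa> (x k)"
    using read_occurs_at[OF occurs_low[OF k_less] order_refl] by simp
  finally show ?thesis by (simp add: take_bit_eq_mod)
qed

lemma ev_residue: "ev (x_residue K) = residue k"
proof (cases "q = 1")
  case True
  \<comment> \<open>Everything is 0 modulo 1, so it does not matter if the divisor overflows or
    \<open>R\<close> is misread.\<close>
  have "ev (x_residue K) = ev (Bin Div (x_R K)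
      (Bin Mod (Pow2 (Bin Mul x_v x_idx)) (Bin Sub (Pow2 x_v) (x_q K)))) mod q"
    unfolding x_residue_def by (rule qr.ev_Mod[OF refl ev_q])
  then show ?thesis using True by (simp add: residue_def del: eval.simps)
next
  case False
  note hb = h_bound[OF False]
  have v1: "(h * n + 1) * 1 \<le> (h * n + 1) * n" using n_pos by (intro mult_le_mono2)
  have vk: "(h * n + 1) * k \<le> (h * n + 1) * n" using k_less by (intro mult_le_mono2) simp
  have ww: "w < 2 ^ w" by simp
  have vw: "h * n + 1 < w" using v1 hb by simp
  then have "h * n + 1 < 2 ^ w" using ww by linarith
  then have v: "ev x_v = h * n + 1"
    unfolding x_v_def by (intro qr.ev_Add qr.ev_Mul ev_h qr.ev_Lit_small qr.ev_Var) auto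
  have vkw: "(h * n + 1) * k < w" using vk hb by (rule le_less_trans)
  then have "(h * n + 1) * k < 2 ^ w" using ww by (rule less_trans)
  then have "ev (Bin Mul x_v x_idx) = (h * n + 1) * k"
    by (intro qr.ev_Mul v ev_idx)
  then have p1: "ev (Pow2 (Bin Mul x_v x_idx)) = 2 ^ ((h * n + 1) * k)"
    using vkw by (rule qr.ev_Pow2)
  from vw have p2: "ev (Pow2 x_v) = 2 ^ (h * n + 1)" by (intro qr.ev_Pow2 v)
  have "q \<le> 2 ^ (h * n + 1)" using q_power_bound[OF k_less] by linarith
  moreover have "(2::nat) ^ (h * n + 1) < 2 ^ w" using vw by (intro power_strict_increasing) auto
  ultimately have "ev (Bin Sub (Pow2 x_v) (x_q K)) = 2 ^ (h * n + 1) - q"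
    by (intro qr.ev_Sub p2 ev_q)
  then have "ev (Bin Mod (Pow2 (Bin Mul x_v x_idx)) (Bin Sub (Pow2 x_v) (x_q K)))
      = 2 ^ ((h * n + 1) * k) mod (2 ^ (h * n + 1) - q)"
    by (rule qr.ev_Mod[OF p1])
  then have pw: "ev (Bin Mod (Pow2 (Bin Mul x_v x_idx)) (Bin Sub (Pow2 x_v) (x_q K))) = q ^ k"
    using power_via_mod[OF q_power_bound[OF k_less]] by simp
  have R: "ev (x_R K) = R"
  proof -
    have "2 ^ w div 2 < (2::nat) ^ w" by simp
    then have "n * \<kappa> < 2 ^ w" using \<kappa>_bounds(2) by linarith
    then have t: "ev (Bin Mul (Var 1) (x_kappa K)) = n * \<kappa>" by (intro qr.ev_Mul qr.ev_Var ev_kappa)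
    have "ev (x_R K) = take_bit w (drop_bit (low_pos + n * \<kappa>) (bits_val layout))"
      unfolding x_R_def by (intro read_data ev_hdr_fields t qr.ev_Var \<kappa>_bounds) auto
    also have "\<dots> = take_bit w R" by (simp add: drop_bit_R)
    also have "\<dots> = R"
    proof (rule take_bit_nat_eq_self)
      have "R < q ^ n" unfolding R_def by (intro radix_less residue_less)
      also have "\<dots> \<le> (2 ^ h) ^ n" using q_less by (intro power_mono) auto
      also have "\<dots> = 2 ^ (h * n)" by (simp add: power_mult)
      also have "\<dots> \<le> 2 ^ w" using vw by (intro power_increasing) auto
      finally show "R < 2 ^ w" .
    qed
    finally show ?thesis .
  qed
  have "ev (x_residue K) = R div q ^ k mod q"
    unfolding x_residue_def by (intro qr.ev_Mod qr.ev_Div R pw ev_q)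
  also have "\<dots> = residue k"
    unfolding R_def by (intro radix_digit residue_less k_less)
  finally show ?thesis .
qed

lemma ev_elem: "ev (x_elem K) = x k"
proof -
  let ?X = "x k div 2 ^ \<kappa>"
  have "x k div Q = ?X div q" unfolding Q_def by (simp add: mult.commute[of q] div_mult2_eq)
  then have 1: "x k div Q * q + residue k = ?X" by (simp add: residue_def)
  have 2: "?X * 2 ^ \<kappa> + x k mod 2 ^ \<kappa> = x k" by (rule div_mult_mod_eq)
  have xw: "x k < 2 ^ w" using x_less[OF k_less] m_less by linarith
  have Xw: "?X < 2 ^ w" using xw by (meson div_le_dividend le_less_trans)
  have "ev (Bin Add (Bin Mul (x_Y K) (x_q K)) (x_residue K)) = x k div Q * q + residue k"
    using Xw 1 by (intro qr.ev_Add qr.ev_Mul ev_Y ev_q ev_residue) linarith+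
  then have 3: "ev (Bin Add (Bin Mul (x_Y K) (x_q K)) (x_residue K)) = ?X" using 1 by simp
  have "ev (x_elem K) = ?X * 2 ^ \<kappa> + x k mod 2 ^ \<kappa>"
    unfolding x_elem_def
    using xw 2 by (intro qr.ev_Add[OF qr.ev_Mul[OF 3 ev_pow_kappa] ev_low]) linarith+
  then show ?thesis using 2 by simp
qed

end

text \<open>The other branch serves small word sizes: each element fills one word, and word
  \<open>i - 1\<close> is the answer.\<close>

definition x_select :: "nat \<Rightarrow> nat \<Rightarrow> expr" where
  "x_select K W = If_Less (Lit (2 ^ W - 1)) (Var 3) (x_elem K) (Fetch x_idx)"

lemma vars_x_select: "vars (x_select K W) \<subseteq> {..<4}"
  by (simp add: x_select_def vars_x_elem vars_x_base)

text \<open>Even after truncation to \<open>w\<close> bits, a literal consisting of ones decides whether the word size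
  is small.\<close>

lemma take_bit_ones_less_iff: "take_bit w (2 ^ W - 1) < w \<longleftrightarrow> 2 ^ W - 1 < (w::nat)"
proof -
  have "take_bit w (2 ^ W - 1 :: nat) = 2 ^ min w W - 1"
    using take_bit_of_mask[of w W, where ?'a = nat] by (simp add: mask_eq_exp_minus_1)
  moreover have "w \<le> 2 ^ w - 1" using less_exp[of w] by linarith
  moreover have "w \<le> 2 ^ W - 1" if "w \<le> W" using that less_exp[of W] by linarith
  ultimately show ?thesis by (cases "w \<le> W") (auto simp: min_def)
qed

theorem theorem6p4:
  "\<exists>f :: nat \<Rightarrow> real. f \<in> o(\<lambda>n. real n) \<and>
     (\<forall>w :: nat \<Rightarrow> nat.
        (\<lambda>m. real (w m)) \<in> \<Theta>(\<lambda>m. log 2 (real m)) \<and> (\<forall>m\<ge>1. m < 2 ^ w m) \<longrightarrow>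
        (\<exists>(P :: instr list) (T :: nat). \<forall>m\<ge>1. \<forall>n\<le>m. \<forall>S\<subseteq>{..<m}. card S = n \<longrightarrow>
           (\<exists>bits :: bool list.
              real (length bits) \<le> of_int (info_bound n m) + f n \<and>
              supports_select P T (w m) n m S bits)))"
proof -
  obtain K W where K: "4 \<le> K" and W: "8 \<le> W"
    and ov_ptr: "\<And>n. 1 \<le> n \<Longrightarrow> overhead K n + 6 * n * bit_length n \<le> 2 ^ ptr_width K n"
    and ov_word: "\<And>w n. W \<le> w \<Longrightarrow> n < 2 ^ w \<Longrightarrow> 8 * overhead K n \<le> 2 ^ w"
    using overhead_bounds by blast
  \<comment> \<open>The price of verbatim storage for \<open>w < 2 ^ W\<close>: then
    \<open>n \<le> m < 2 ^ w\<close> keeps \<open>n\<close> below \<open>2 ^ 2 ^ W\<close>, so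
    \<open>c\<close> vanishes eventually.\<close>
  define c :: "nat \<Rightarrow> real" where "c n = (if n < 2 ^ 2 ^ W then real n * 2 ^ W else 0)" for n
  define f :: "nat \<Rightarrow> real" where
    "f n = real (overhead K n) + 1 + 3 * real n / real (bit_length n) + c n" for n
  have f0: "0 \<le> f n" "c n \<le> f n" "real (overhead K n) + 1 + 3 * real n / real (bit_length n) \<le> f n" for n
    by (auto simp: f_def c_def)
  have "f \<in> o(\<lambda>n. real n)"
  proof -
    have "eventually (\<lambda>n. c n = 0) sequentially"
      using eventually_ge_at_top[of "2 ^ 2 ^ W"] by eventually_elim (simp add: c_def)
    then have "c \<in> o(\<lambda>n. real n)"
      by (subst landau_o.small.in_cong) auto
    moreover have "(\<lambda>n. 1) \<in> o(\<lambda>n::nat. real n)" by real_asymp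
    ultimately show ?thesis
      unfolding f_def using overhead_smallo[of K] slack_smallo by (intro sum_in_smallo)
  qed
  moreover have "\<exists>bits :: bool list. real (length bits) \<le> of_int (info_bound n m) + f n \<and>
      supports_select (program (x_select K W)) (Suc (code_size (x_select K W))) w n m S bits"
    if m: "1 \<le> m" "m < 2 ^ w" "n \<le> m" and S: "S \<subseteq> {..<m}" "card S = n" for w n m S
  proof -
    have "log 2 (real (m choose n)) \<le> of_int (info_bound n m)"
      by (simp add: info_bound_def)
    moreover have "1 \<le> m choose n" using m(3) by (simp add: Suc_le_eq)
    then have "0 \<le> log 2 (real (m choose n))" by (subst zero_le_log_cancel_iff) linarith+
    ultimately have info: "log 2 (real (m choose n)) \<le> of_int (info_bound n m)"
      "0 \<le> real_of_int (info_bound n m)" by linarith+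
    define x where "x k = sorted_list_of_set S ! k" for k
    have fin: "finite S" using S(1) finite_subset by blast
    have len: "length (sorted_list_of_set S) = n" using S(2) by simp
    have x_mono: "x j < x k" if "j < k" "k < n" for j k
      unfolding x_def using that len by (intro sorted_wrt_nth_less[of "(<)"]) auto
    have x_less: "x k < m" if "k < n" for k
    proof -
      have "x k \<in> set (sorted_list_of_set S)" unfolding x_def using that len by (intro nth_mem) simp
      then show ?thesis using fin S(1) by auto
    qed
    have sel: "select i S = x (i - 1)" for i by (simp add: select_def x_def)
    show ?thesis
    proof (cases "2 ^ W - 1 < w")
      case True
      show ?thesis
      proof (cases "n = 0")
        case True
        then show ?thesis
          using info f0(1)[of n] by (intro exI[of _ "[]"]) (simp add: supports_select_def)
      next
        case False
        have W2: "W \<le> w" using True less_exp[of W] by linarith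
        have "(2::nat) ^ 8 \<le> 2 ^ W" using W by (intro power_increasing) auto
        then have w: "256 \<le> w" using True by simp
        interpret elements w n m K x
          using m W2 w K x_mono x_less ov_ptr ov_word False by unfold_locales auto
        have "real (length layout) \<le> of_int (info_bound n m) + f n"
          using length_layout_le info f0(3)[of n] by linarith
        moreover have "supports_select (program (x_select K W)) (Suc (code_size (x_select K W))) w n m S layout"
        proof (rule supports_select_programI[OF vars_x_select])
          fix i assume i: "i \<in> {1..n}"
          interpret elements_query w n m K x i
            using i by unfold_locales auto
          show "eval w (pack w layout) (query_regs w n m i) (x_select K W) = select i S"
            using ev_elem iffD2[OF take_bit_ones_less_iff True]
            by (simp add: x_select_def sel query_regs_def)
        qed
        ultimately show ?thesis by blast
      qed
    next
      case False
      let ?bits = "concat (map (\<lambda>k. nat_bits w (x k)) [0..<n])"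
      have "length ?bits = n * w" by (induction n) auto
      moreover have "real n * real w \<le> c n"
      proof -
        have "w < 2 ^ W" using False by (metis One_nat_def Suc_pred not_less_eq zero_less_numeral zero_less_power)
        then have "(2::nat) ^ w \<le> 2 ^ 2 ^ W" by (intro power_increasing) auto
        then have "n < 2 ^ 2 ^ W" using m by linarith
        moreover have "real w \<le> 2 ^ W" using \<open>w < 2 ^ W\<close>
          by (metis less_imp_le of_nat_le_iff of_nat_numeral of_nat_power)
        ultimately show ?thesis by (simp add: c_def mult_left_mono)
      qed
      ultimately have "real (length ?bits) \<le> of_int (info_bound n m) + f n"
        using info(2) f0(2)[of n] by simp
      moreover have "supports_select (program (x_select K W)) (Suc (code_size (x_select K W))) w n m S ?bits"
      proof (rule supports_select_programI[OF vars_x_select])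
        fix i assume i: "i \<in> {1..n}"
        let ?ev = "eval w (pack w ?bits) (query_regs w n m i)"
        \<comment> \<open>Here \<open>w\<close> may be smaller than 8, so the index is evaluated
          directly instead of by the rules of \<open>query\<close>; \<open>1 \<le> w\<close> is
          enough for the literal 1.\<close>
        have w0: "1 \<le> w" using m by (cases w) auto
        have "i - 1 < 2 ^ w" using i m by (meson atLeastAtMost_iff le_less_trans diff_le_self)
        then have "take_bit w ((i - 1) + 2 ^ w) = i - 1" unfolding take_bit_eq_mod by simp
        moreover have "(i - 1) + 2 ^ w = i + 2 ^ w - 1" using i by simp
        ultimately have "take_bit w (i + 2 ^ w - 1) = i - 1" by (simp only:)
        then have idx: "?ev x_idx = i - 1"
          using w0 by (simp add: x_idx_def query_regs_def)
        have "i - 1 < n" using i by auto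
        then have "occurs_at ?bits ((i - 1) * w) (nat_bits w (x (i - 1)))"
          using occurs_at_concat_map[OF occurs_at_self, of "i - 1" n "\<lambda>k. nat_bits w (x k)"] by simp
        moreover have "x (i - 1) < 2 ^ w" using x_less[OF \<open>i - 1 < n\<close>] m by linarith
        ultimately have "pack w ?bits (i - 1) = x (i - 1)"
          unfolding pack_eq by (rule read_field)
        then have "?ev (Fetch x_idx) = x (i - 1)" using idx by simp
        then show "?ev (x_select K W) = select i S"
          using False take_bit_ones_less_iff[of w W] by (simp add: x_select_def sel query_regs_def)
      qed
      ultimately show ?thesis by blast
    qed
  qed
  ultimately show ?thesis by (intro exI[of _ f]) blast
qed

end
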